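(* Let $p,q$ be constants with $1\le p<d$ and $p\le q\le \frac{dp}{d-p}$, and put $\gamma:=\frac1p-\frac1q$. There exists a constant $S(\Omega,\eta)>0$, depending only on the kernel $\eta$ and the domain $\Omega$, such that the following holds. Assume: (i) for some $K\le S(\Omega,\eta)$ (with $K>0$) there is a sequence of Borel maps $T_n:\Omega\to V_n$ with $T_n\#\mu=\mu_n$ and $\sup_{x\in\Omega}|T_n(x)-x|\le K\varepsilon_n$ for every $n\in\mathbb N$; (ii) $\eta$ is continuous at $0$, non-increasing, and $\eta(0)>0$; (iii) there is $D>0$ with $\frac1D\le\rho(x)\le D$ for all $x\in\Omega$; and there exists $t>q$ such that $\aleph_\eta^t<+\infty$. Consider the uniform graph Sobolev inequality: there exists a constant $C>0$ such that for every $n\in\mathbb N$ and every $u:V_n\to\mathbb R$, $$\|u\|_{L^q(V_n;\mu_n)}\le C\left(\|u\|_{L^p(V_n;\mu_n)}+(\mathcal{GE}_n^p(u))^{1/p}\right).\qquad(\ast)$$ Then $(\ast)$ holds if the sequence $$\left(\frac{\varepsilon_n(\Lambda_n^+)^{1/q+1/p}}{(\Lambda_n^-)^{2/p}}\right)_{n\in\mathbb N}$$ is bounded. Moreover, if in addition (iv) there is $\mathfrak D>0$ such that $\frac{1}{\mathfrak D|V_n|}\le\mu_n(x)\le\frac{\mathfrak D}{|V_n|}$ for all $n\in\mathbb N$ and $x\in V_n$, then $(\ast)$ holds if and only if the sequence $\left(\varepsilon_n|V_n|^\gamma\right)_{n\in\mathbb N}$ is bounded.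
   Context: $\mathbb N=\{1,2,\dots\}$; $d\in\mathbb N$; $\Omega\subset\mathbb R^d$ is open and bounded with Lipschitz boundary (near each boundary point, in suitable orthonormal coordinates, $\Omega$ is the region on one side of the graph of a Lipschitz function). $\mu$ is a probability measure on $\Omega$ with continuous density $\rho:\Omega\to\mathbb R$ with respect to Lebesgue measure. For $n\in\mathbb N$, $V_n\subset\Omega$ is a finite set, $\mu_n$ is a probability measure on $V_n$ (also regarded as a measure on $\Omega$), $\mu_n(x):=\mu_n(\{x\})$, $\Lambda_n^-:=\min_{x\in V_n}\mu_n(x)$, $\Lambda_n^+:=\max_{x\in V_n}\mu_n(x)$. $(\varepsilon_n)_{n\in\mathbb N}$ is a sequence of positive reals with $\varepsilon_n\to0$. The kernel is a function $\eta:[0,\infty)\to[0,\infty)$, and $\eta_\varepsilon(r):=\varepsilon^{-d}\eta(r/\varepsilon)$ for $\varepsilon>0$. For $t\ge0$, $\aleph_\eta^t:=\int_0^\infty\eta(r)r^{d+t-1}\,dr$. The push-forward is $T\#\mu(A):=\mu(T^{-1}(A))$. For $u:V_n\to\mathbb R$ and $p\ge1$, $$\|u\|_{L^p(V_n;\mu_n)}:=\Big(\sum_{x\in V_n}|u(x)|^p\mu_n(x)\Big)^{1/p},\qquad \mathcal{GE}_n^p(u):=\frac1{\varepsilon_n^p}\sum_{x\in V_n}\sum_{y\in V_n}\eta_{\varepsilon_n}(|x-y|)|u(x)-u(y)|^p\mu_n(x)\mu_n(y).$$ *)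

theory Defs
  imports "HOL-Probability.Probability"
begin

text \<open>
  The orthonormal coordinates near a boundary point are given by the unit vector \<open>e\<close> (vertical
  direction) together with its orthogonal complement, which carries the Lipschitz function \<open>g\<close>;
  \<open>y - (y \<bullet> e) *\<^sub>R e\<close> is the orthogonal projection of \<open>y\<close> onto that hyperplane.
\<close>

definition lipschitz_boundary :: "'a::euclidean_space set \<Rightarrow> bool" where
  "lipschitz_boundary \<Omega> \<longleftrightarrow>
    (\<forall>z\<in>frontier \<Omega>. \<exists>e g L U.
        norm e = 1 \<and> L-lipschitz_on {v. v \<bullet> e = 0} g \<and> open U \<and> z \<in> U \<and>
        \<Omega> \<inter> U = {y \<in> U. y \<bullet> e < (g (y - (y \<bullet> e) *\<^sub>R e) :: real)})"

definition scaled_kernel :: "nat \<Rightarrow> (real \<Rightarrow> real) \<Rightarrow> real \<Rightarrow> real \<Rightarrow> real" where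
  "scaled_kernel d \<eta> \<epsilon> r = \<eta> (r / \<epsilon>) / \<epsilon> ^ d"

definition kernel_moment :: "nat \<Rightarrow> (real \<Rightarrow> real) \<Rightarrow> real \<Rightarrow> ennreal" where
  "kernel_moment d \<eta> t = (\<integral>\<^sup>+r\<in>{0..}. ennreal (\<eta> r * r powr (real d + t - 1)) \<partial>lborel)"

definition graph_Lp_norm :: "'a set \<Rightarrow> 'a measure \<Rightarrow> real \<Rightarrow> ('a \<Rightarrow> real) \<Rightarrow> real" where
  "graph_Lp_norm V \<nu> p u = (\<Sum>x\<in>V. \<bar>u x\<bar> powr p * measure \<nu> {x}) powr (1 / p)"

definition graph_energy ::
    "(real \<Rightarrow> real) \<Rightarrow> 'a::euclidean_space set \<Rightarrow> 'a measure \<Rightarrow> real \<Rightarrow> real \<Rightarrow> ('a \<Rightarrow> real) \<Rightarrow> real" where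
  "graph_energy \<eta> V \<nu> \<epsilon> p u =
     1 / \<epsilon> powr p *
     (\<Sum>x\<in>V. \<Sum>y\<in>V. scaled_kernel DIM('a) \<eta> \<epsilon> (norm (x - y)) * \<bar>u x - u y\<bar> powr p
                      * measure \<nu> {x} * measure \<nu> {y})"

definition min_weight :: "'a set \<Rightarrow> 'a measure \<Rightarrow> real" where
  "min_weight V \<nu> = Min ((\<lambda>x. measure \<nu> {x}) ` V)"

definition max_weight :: "'a set \<Rightarrow> 'a measure \<Rightarrow> real" where
  "max_weight V \<nu> = Max ((\<lambda>x. measure \<nu> {x}) ` V)"

text \<open>
  Sequences are indexed by \<open>n \<ge> 1\<close>; their values at \<open>0\<close> are irrelevant throughout.
\<close>

definition uniform_graph_sobolev ::
    "(real \<Rightarrow> real) \<Rightarrow> (nat \<Rightarrow> 'a::euclidean_space set) \<Rightarrow> (nat \<Rightarrow> 'a measure) \<Rightarrow> (nat \<Rightarrow> real)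
      \<Rightarrow> real \<Rightarrow> real \<Rightarrow> bool" where
  "uniform_graph_sobolev \<eta> V \<nu> \<epsilon> p q \<longleftrightarrow>
    (\<exists>C>0. \<forall>n\<ge>1. \<forall>u.
       graph_Lp_norm (V n) (\<nu> n) q u
         \<le> C * (graph_Lp_norm (V n) (\<nu> n) p u + graph_energy \<eta> (V n) (\<nu> n) (\<epsilon> n) p u powr (1 / p)))"

text \<open>
  The measure \<open>\<mu>\<close> lives on the Borel sets of \<open>\<Omega>\<close>, and \<open>\<nu> n\<close> (the measure \<open>\<mu>\<^sub>n\<close>) on all subsets of
  the finite set \<open>V n\<close>.
\<close>

definition graph_setting ::
    "'a::euclidean_space set \<Rightarrow> 'a measure \<Rightarrow> ('a \<Rightarrow> real) \<Rightarrow> (nat \<Rightarrow> 'a set) \<Rightarrow> (nat \<Rightarrow> 'a measure)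
      \<Rightarrow> (nat \<Rightarrow> real) \<Rightarrow> bool" where
  "graph_setting \<Omega> \<mu> \<rho> V \<nu> \<epsilon> \<longleftrightarrow>
     prob_space \<mu> \<and> continuous_on \<Omega> \<rho> \<and> (\<forall>x\<in>\<Omega>. 0 \<le> \<rho> x) \<and>
     \<mu> = density (restrict_space lborel \<Omega>) (\<lambda>x. ennreal (\<rho> x)) \<and>
     (\<forall>n\<ge>1. finite (V n) \<and> V n \<subseteq> \<Omega> \<and> prob_space (\<nu> n) \<and> sets (\<nu> n) = Pow (V n)) \<and>
     (\<forall>n\<ge>1. 0 < \<epsilon> n) \<and> \<epsilon> \<longlonglongrightarrow> 0"

end

theory Submission
  imports Defs
begin

text \<open>
The graph inequality is proved directly on the vertices, by comparing the weighted point cloud with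
a lattice whose mesh is a fixed multiple of \<open>\<epsilon>\<close>.

A point cloud that is the image of \<open>\<mu>\<close> under a map of displacement at most \<open>K * \<epsilon>\<close> gives every
ball of radius at least \<open>K * \<epsilon>\<close> a weight comparable to its volume
(\<open>transported_measure_ball_regular\<close>). If \<open>K\<close> is small, the cells of a grid of mesh
comparable to \<open>\<epsilon>\<close> that lie inside \<open>\<Omega>\<close> therefore all carry weight comparable to \<open>\<epsilon> ^ DIM('a)\<close>.
The kernel is bounded below near \<open>0\<close>, so the graph energy controls the oscillation of \<open>u\<close> inside
cells and between neighbouring cells. Averaging \<open>u\<close> over cells yields a function on \<open>\<int>\<^sup>d\<close> with
controlled differences, to which the Sobolev inequality on the lattice applies.

Two points need care. First, near the boundary the cells of \<open>\<Omega>\<close> are not all of \<open>\<int>\<^sup>d\<close>, and no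
extension operator is used. A Lipschitz domain contains a cone of directions at each of its points
(\<open>lipschitz_boundary_local_cone\<close>). The grid is built from a basis taken inside this cone
(\<open>slanted_grid\<close>), so that from a cell in \<open>\<Omega>\<close> one may walk in every positive coordinate
direction, without leaving \<open>\<Omega>\<close>, until a cutoff function vanishes. The proof of Gagliardo and
Nirenberg needs the differences only along such half-lines, which is why the lattice inequality
\<open>lattice_Sobolev\<close> has a one-sided hypothesis. Points whose own cell sticks out of \<open>\<Omega>\<close> are compared
with a cell slightly further inside the cone.

Secondly, the cell averages see nothing below the scale \<open>\<epsilon>\<close>. The difference between \<open>u\<close> and its
cell average has \<open>L\<^sup>p\<close> norm at most a multiple of \<open>\<epsilon>\<close> times the energy and \<open>L\<^sup>p\<close> norms of
\<open>u\<close>, and on a finite space whose atoms have weight at least \<open>w\<close> the \<open>L\<^sup>q\<close> norm is at most \<open>w powr - (1/p - 1/q)\<close> times the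
\<open>L\<^sup>p\<close> norm (\<open>inverse_inequality\<close>). So this part is harmless as long as
\<open>\<epsilon> * w powr - (1/p - 1/q)\<close> stays bounded, where \<open>w\<close> is the smallest weight, and the
boundedness conditions of the theorem imply this. Conversely, inserting the indicator function of
a vertex into the Sobolev inequality shows that the condition is necessary when all weights are comparable: the
moment condition makes the total kernel weight seen from a vertex bounded (\<open>kernel_sum_bound\<close>).
\<close>

section \<open>Inequalities for real powers and weighted sums\<close>

lemma weighted_arith_geom_mean:
  fixes a b \<alpha> \<beta> :: real
  assumes "0 < \<alpha>" "0 < \<beta>" "\<alpha> + \<beta> = 1" "0 \<le> a" "0 \<le> b"
  shows "a powr \<alpha> * b powr \<beta> \<le> \<alpha> * a + \<beta> * b"
proof (cases "a = 0 \<or> b = 0")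
  case True
  then show ?thesis using assms by auto
next
  case False
  then show ?thesis using assms by (intro Youngs_inequality_0) auto
qed

lemma powr_power_pos:
  fixes z u :: real
  assumes "0 < n"
  shows "(z powr u) ^ n = z powr (real n * u)"
  using assms by (cases "z = 0") (auto simp: powr_power zero_power)

text \<open>
The graph of the convex function \<open>t powr s\<close> lies above its tangent at \<open>a\<close>. In this form, a rearranged
Young inequality, it yields both Jensen's inequality and the chain rule for finite differences
below, with only the power of \<open>a\<close> on the right.
\<close>
lemma powr_tangent:
  fixes a b s :: real
  assumes "0 \<le> a" "0 \<le> b" "1 \<le> s"
  shows "a powr s - b powr s \<le> s * (a - b) * a powr (s - 1)"
proof (cases "s = 1")
  case True
  then show ?thesis using assms by (cases "a = 0") auto
next
  case False
  then have "s > 1" using assms by simp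
  then have "(b powr s) powr (1/s) * (a powr s) powr (1 - 1/s) \<le> 1/s * b powr s + (1 - 1/s) * a powr s"
    by (intro weighted_arith_geom_mean) auto
  moreover have "(b powr s) powr (1/s) = b" using assms by (simp add: powr_powr)
  moreover have "(a powr s) powr (1 - 1/s) = a powr (s - 1)"
    using assms by (simp add: powr_powr algebra_simps)
  ultimately have "b * a powr (s - 1) \<le> 1/s * b powr s + (1 - 1/s) * a powr s"
    by simp
  then have "s * (b * a powr (s - 1)) \<le> s * (1/s * b powr s + (1 - 1/s) * a powr s)"
    using assms by (intro mult_left_mono) auto
  also have "\<dots> = b powr s + (s - 1) * a powr s" using assms by (simp add: field_simps)
  finally have *: "s * b * a powr (s - 1) \<le> b powr s + (s - 1) * a powr s" by simp
  have "a * a powr (s - 1) = a powr s"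
    using assms by (cases "a = 0") (simp_all add: powr_mult_base)
  moreover have "s * (a - b) * a powr (s - 1) = s * (a * a powr (s - 1)) - s * b * a powr (s - 1)"
    by (simp only: algebra_simps)
  ultimately have "s * (a - b) * a powr (s - 1) = s * a powr s - s * b * a powr (s - 1)" by simp
  then show ?thesis using * by (simp add: left_diff_distrib)
qed

text \<open>
Jensen's inequality: sum the tangent inequality at the mean; the linear terms cancel.
\<close>
lemma powr_weighted_mean_le:
  fixes m a :: "'b \<Rightarrow> real"
  assumes "\<And>i. i \<in> A \<Longrightarrow> 0 \<le> m i" "\<And>i. i \<in> A \<Longrightarrow> 0 \<le> a i" "0 < sum m A" "1 \<le> p"
  shows "((\<Sum>i\<in>A. m i * a i) / sum m A) powr p \<le> (\<Sum>i\<in>A. m i * a i powr p) / sum m A"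
proof -
  define c where "c = (\<Sum>i\<in>A. m i * a i) / sum m A"
  have c0: "0 \<le> c" unfolding c_def using assms by (intro divide_nonneg_nonneg sum_nonneg) auto
  have cs: "c * sum m A = (\<Sum>i\<in>A. m i * a i)" using assms by (simp add: c_def)
  have "(\<Sum>i\<in>A. m i * (c powr p - a i powr p)) \<le> (\<Sum>i\<in>A. m i * (p * (c - a i) * c powr (p - 1)))"
    by (intro sum_mono mult_left_mono powr_tangent assms c0)
  also have "\<dots> = p * c powr (p-1) * (c * sum m A - (\<Sum>i\<in>A. m i * a i))"
    by (simp add: sum_distrib_left sum_subtractf algebra_simps)
  also have "\<dots> = 0" using cs by simp
  finally have "c powr p * sum m A \<le> (\<Sum>i\<in>A. m i * a i powr p)"
    by (simp add: right_diff_distrib sum_subtractf flip: sum_distrib_right)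
       (simp add: mult.commute)
  then show ?thesis using assms unfolding c_def by (simp add: field_simps)
qed

lemma sum_powr_Hoelder:
  fixes f g :: "'b \<Rightarrow> real"
  assumes "finite A" "\<And>i. i \<in> A \<Longrightarrow> 0 \<le> f i" "\<And>i. i \<in> A \<Longrightarrow> 0 \<le> g i" "0 < \<alpha>" "0 < \<beta>" "\<alpha> + \<beta> = 1"
  shows "(\<Sum>i\<in>A. f i powr \<alpha> * g i powr \<beta>) \<le> sum f A powr \<alpha> * sum g A powr \<beta>"
proof (cases "sum f A = 0 \<or> sum g A = 0")
  case True
  then have "\<forall>i\<in>A. f i powr \<alpha> * g i powr \<beta> = 0"
    using assms by (auto simp: sum_nonneg_eq_0_iff)
  then have "(\<Sum>i\<in>A. f i powr \<alpha> * g i powr \<beta>) = 0" by (rule sum.neutral)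
  then show ?thesis by simp
next
  case False
  define F G where "F = sum f A" and "G = sum g A"
  have pos: "F > 0" "G > 0" using False assms sum_nonneg[of A f] sum_nonneg[of A g]
    by (auto simp: F_def G_def)
  have "(\<Sum>i\<in>A. (f i / F) powr \<alpha> * (g i / G) powr \<beta>) \<le> (\<Sum>i\<in>A. \<alpha> * (f i / F) + \<beta> * (g i / G))"
    using assms pos by (intro sum_mono weighted_arith_geom_mean) auto
  also have "\<dots> = \<alpha> * (sum f A / F) + \<beta> * (sum g A / G)"
    by (simp add: sum.distrib sum_distrib_left sum_divide_distrib)
  also have "\<dots> = 1" using pos assms by (simp add: F_def[symmetric] G_def[symmetric])
  finally have "(\<Sum>i\<in>A. f i powr \<alpha> * g i powr \<beta>) / (F powr \<alpha> * G powr \<beta>) \<le> 1"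
    using assms pos by (simp add: powr_divide sum_divide_distrib)
  then show ?thesis using pos by (simp add: F_def[symmetric] G_def[symmetric])
qed

text \<open>
Hoelder's inequality for several factors with equal exponents: normalise every factor to have
sum \<open>1\<close> and apply the inequality of arithmetic and geometric means pointwise.
\<close>
lemma sum_prod_powr_Hoelder:
  fixes a :: "'i \<Rightarrow> 'b \<Rightarrow> real"
  assumes "finite A" "finite I" "I \<noteq> {}" "\<And>i s. i \<in> I \<Longrightarrow> s \<in> A \<Longrightarrow> 0 \<le> a i s"
  shows "(\<Sum>s\<in>A. \<Prod>i\<in>I. a i s powr (1 / card I)) \<le> (\<Prod>i\<in>I. (\<Sum>s\<in>A. a i s) powr (1 / card I))"
proof (cases "\<exists>i\<in>I. sum (a i) A = 0")
  case True
  then obtain i where i: "i \<in> I" "\<forall>s\<in>A. a i s = 0"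
    using assms by (auto simp: sum_nonneg_eq_0_iff)
  then have "\<forall>s\<in>A. (\<Prod>i\<in>I. a i s powr (1 / card I)) = 0"
    using assms by (auto intro!: prod_zero)
  then show ?thesis by (simp add: prod_nonneg)
next
  case False
  define N where "N i = sum (a i) A" for i
  have N: "N i > 0" if "i \<in> I" for i
    using False assms that sum_nonneg[of A "a i"] by (force simp: N_def)
  have cI: "real (card I) > 0" using assms by (simp add: card_gt_0_iff)
  have "(\<Sum>s\<in>A. \<Prod>i\<in>I. (a i s / N i) powr (1 / card I)) \<le> (\<Sum>s\<in>A. \<Sum>i\<in>I. (a i s / N i) / card I)"
  proof (rule sum_mono)
    fix s assume "s \<in> A"
    then have nn: "\<And>i. i \<in> I \<Longrightarrow> 0 \<le> a i s / N i" using assms N by (simp add: less_imp_le)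
    have "(\<Prod>i\<in>I. (a i s / N i) powr (1 / card I)) = (\<Prod>i\<in>I. a i s / N i) powr (1 / card I)"
      by (rule prod_powr_distrib[symmetric])
    also have "\<dots> \<le> (\<Sum>i\<in>I. (a i s / N i) / card I)"
      by (intro arith_geom_mean assms nn)
    finally show "(\<Prod>i\<in>I. (a i s / N i) powr (1 / card I)) \<le> (\<Sum>i\<in>I. (a i s / N i) / card I)" .
  qed
  also have "\<dots> = (\<Sum>i\<in>I. (sum (a i) A / N i) / card I)"
    by (subst sum.swap) (simp add: sum_divide_distrib)
  also have "\<dots> = (\<Sum>i\<in>I. 1 / card I)"
    using less_imp_neq[OF N] by (intro sum.cong refl) (auto simp: N_def)
  also have "\<dots> = 1" using cI by simp
  finally have *: "(\<Sum>s\<in>A. \<Prod>i\<in>I. (a i s / N i) powr (1 / card I)) \<le> 1" .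
  have nz: "\<forall>i\<in>I. N i \<noteq> 0" using N by fastforce
  have "(\<Sum>s\<in>A. \<Prod>i\<in>I. (a i s / N i) powr (1 / card I))
      = (\<Sum>s\<in>A. \<Prod>i\<in>I. a i s powr (1 / card I)) / (\<Prod>i\<in>I. N i powr (1 / card I))"
    unfolding sum_divide_distrib prod_dividef[symmetric]
    by (intro sum.cong prod.cong refl powr_divide)
  moreover have "(\<Prod>i\<in>I. N i powr (1 / card I)) > 0" using nz by (intro prod_pos) auto
  ultimately show ?thesis using * by (simp add: N_def)
qed

section \<open>A one-sided Sobolev inequality on the integer lattice\<close>

lemma sum_PiE_insert:
  assumes "j \<notin> I"
  shows "(\<Sum>k\<in>Pi\<^sub>E (insert j I) (\<lambda>_. S). F k) = (\<Sum>s\<in>S. \<Sum>k\<in>Pi\<^sub>E I (\<lambda>_. S). F (k(j := s)))"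
  unfolding PiE_insert_eq
  by (subst sum.reindex[OF inj_combinator[OF assms]])
     (simp add: sum.cartesian_product case_prod_unfold comp_def)

text \<open>
The discrete Loomis-Whitney inequality, for functions that are given as sums over the lines
parallel to the axes. The induction adds one coordinate \<open>j\<close>: on each slice of fixed coordinate \<open>j\<close>
Hoelder's inequality separates the factor belonging to \<open>j\<close>, which does not depend on the slice, from the
others, to which the induction hypothesis applies; then the sum over all slices is estimated by
Hoelder's inequality for \<open>card I\<close> factors.
\<close>
lemma Loomis_Whitney:
  fixes D :: "'i \<Rightarrow> ('i \<Rightarrow> 'b) \<Rightarrow> real"
  assumes "finite I" "finite S" "2 \<le> card I" "\<And>i k. 0 \<le> D i k"
  shows "(\<Sum>k\<in>Pi\<^sub>E I (\<lambda>_. S). \<Prod>i\<in>I. (\<Sum>s\<in>S. D i (k(i := s))) powr (1 / (real (card I) - 1)))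
    \<le> (\<Prod>i\<in>I. (\<Sum>k\<in>Pi\<^sub>E I (\<lambda>_. S). D i k) powr (1 / (real (card I) - 1)))"
  using assms(1,3,4)
proof (induction I arbitrary: D rule: finite_induct)
  case empty
  then show ?case by simp
next
  case (insert j I)
  define d where "d = real (card I)"
  let ?X = "Pi\<^sub>E I (\<lambda>_. S)"
  have d1: "d \<ge> 1" "I \<noteq> {}" using insert by (auto simp: d_def)
  have d: "real (card (insert j I)) - 1 = d" using insert by (simp add: d_def)
  have fin: "finite ?X" using insert assms by (simp add: finite_PiE)
  define G where "G k = (\<Sum>s\<in>S. D j (k(j := s)))" for k
  define E where "E s i k = D i (k(j := s))" for s i k
  have G0: "G k \<ge> 0" for k unfolding G_def using insert.prems by (intro sum_nonneg) auto
  have E0: "E s i k \<ge> 0" for s i k unfolding E_def using insert.prems by auto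
  \<comment> \<open>If \<open>I\<close> is a singleton, the exponent of the induction hypothesis would be \<open>1 / 0\<close>;
    the factor then does not depend on \<open>k\<close> at all, and the bound is an identity.\<close>
  have slice: "(\<Sum>k\<in>?X. G k powr (1/d) * (\<Prod>i\<in>I. (\<Sum>t\<in>S. E s i (k(i := t))) powr (1/d)))
      \<le> sum G ?X powr (1/d) * (\<Prod>i\<in>I. (\<Sum>k\<in>?X. E s i k) powr (1/d))" for s
  proof (cases "card I = 1")
    case True
    then obtain i where i: "I = {i}" by (auto simp: card_1_singleton_iff)
    have "d = 1" using True by (simp add: d_def)
    have "(\<Sum>t\<in>S. E s i (k(i := t))) = (\<Sum>k\<in>?X. E s i k)" if "k \<in> ?X" for k
    proof -
      have "k(i := t) = (\<lambda>_. undefined)(i := t)" for t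
        using that by (auto simp: i PiE_def extensional_def)
      then show ?thesis by (simp add: i sum_PiE_insert fun_upd_def)
    qed
    then have "(\<Sum>k\<in>?X. G k powr (1/d) * (\<Prod>i\<in>I. (\<Sum>t\<in>S. E s i (k(i := t))) powr (1/d)))
        = (\<Sum>k\<in>?X. G k * (\<Sum>k\<in>?X. E s i k))"
      unfolding \<open>d = 1\<close> using G0 E0 by (intro sum.cong refl) (simp add: i sum_nonneg)
    also have "\<dots> = sum G ?X * (\<Sum>k\<in>?X. E s i k)" by (simp add: sum_distrib_right)
    finally show ?thesis unfolding \<open>d = 1\<close> using G0 E0 by (simp add: i sum_nonneg)
  next
    case False
    then have d2: "card I \<ge> 2" "d > 1" using insert d1 by (auto simp: d_def)
    define Q where "Q k = (\<Prod>i\<in>I. (\<Sum>t\<in>S. E s i (k(i := t))) powr (1/(d - 1)))" for k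
    have Q0: "Q k \<ge> 0" for k unfolding Q_def by (intro prod_nonneg) auto
    have pw: "(x powr (1/(d-1))) powr ((d-1)/d) = x powr (1/d)" for x :: real
      using d2 by (simp add: powr_powr)
    have *: "(\<Prod>i\<in>I. (\<Sum>t\<in>S. E s i (k(i := t))) powr (1/d)) = Q k powr ((d-1)/d)" for k
      unfolding Q_def by (subst prod_powr_distrib) (simp_all add: pw)
    have "(\<Sum>k\<in>?X. G k powr (1/d) * Q k powr ((d-1)/d)) \<le> sum G ?X powr (1/d) * sum Q ?X powr ((d-1)/d)"
      using d2 fin G0 Q0 by (intro sum_powr_Hoelder) (auto simp: field_simps)
    also have "\<dots> \<le> sum G ?X powr (1/d) * (\<Prod>i\<in>I. (\<Sum>k\<in>?X. E s i k) powr (1/(d-1))) powr ((d-1)/d)"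
    proof -
      have "sum Q ?X \<le> (\<Prod>i\<in>I. (\<Sum>k\<in>?X. E s i k) powr (1/(d-1)))"
        unfolding Q_def d_def using insert.IH[of "E s", OF d2(1) E0] .
      then show ?thesis using Q0 d2 by (intro mult_left_mono powr_mono2) (auto intro!: sum_nonneg)
    qed
    also have "(\<Prod>i\<in>I. (\<Sum>k\<in>?X. E s i k) powr (1/(d-1))) powr ((d-1)/d)
      = (\<Prod>i\<in>I. (\<Sum>k\<in>?X. E s i k) powr (1/d))"
      by (subst prod_powr_distrib) (simp_all add: pw)
    finally show ?thesis unfolding * .
  qed
  have split: "(\<Prod>i\<in>insert j I. (\<Sum>t\<in>S. D i ((k(j := s))(i := t))) powr (1/d))
     = G k powr (1/d) * (\<Prod>i\<in>I. (\<Sum>t\<in>S. E s i (k(i := t))) powr (1/d))" for k s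
  proof -
    have "(\<Sum>t\<in>S. D i ((k(j := s))(i := t))) = (\<Sum>t\<in>S. E s i (k(i := t)))" if "i \<in> I" for i
      using insert.hyps that unfolding E_def by (intro sum.cong refl arg_cong[where f="D i"]) auto
    then show ?thesis
      using insert.hyps by (subst prod.insert) (auto simp: G_def)
  qed
  have "(\<Sum>k\<in>Pi\<^sub>E (insert j I) (\<lambda>_. S). \<Prod>i\<in>insert j I. (\<Sum>s\<in>S. D i (k(i := s))) powr (1 / d))
      = (\<Sum>s\<in>S. \<Sum>k\<in>?X. G k powr (1/d) * (\<Prod>i\<in>I. (\<Sum>t\<in>S. E s i (k(i := t))) powr (1/d)))"
    by (subst sum_PiE_insert[OF insert.hyps(2)]) (simp only: split)
  also have "\<dots> \<le> (\<Sum>s\<in>S. sum G ?X powr (1/d) * (\<Prod>i\<in>I. (\<Sum>k\<in>?X. E s i k) powr (1/d)))"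
    by (intro sum_mono slice)
  also have "\<dots> = sum G ?X powr (1/d) * (\<Sum>s\<in>S. \<Prod>i\<in>I. (\<Sum>k\<in>?X. E s i k) powr (1/d))"
    by (simp add: sum_distrib_left)
  also have "(\<Sum>s\<in>S. \<Prod>i\<in>I. (\<Sum>k\<in>?X. E s i k) powr (1/d))
      \<le> (\<Prod>i\<in>I. (\<Sum>s\<in>S. \<Sum>k\<in>?X. E s i k) powr (1/d))"
    unfolding d_def using assms(2) insert.hyps d1 E0
    by (intro sum_prod_powr_Hoelder) (auto intro!: sum_nonneg)
  finally have "(\<Sum>k\<in>Pi\<^sub>E (insert j I) (\<lambda>_. S). \<Prod>i\<in>insert j I. (\<Sum>s\<in>S. D i (k(i := s))) powr (1 / d))
    \<le> sum G ?X powr (1/d) * (\<Prod>i\<in>I. (\<Sum>s\<in>S. \<Sum>k\<in>?X. E s i k) powr (1/d))"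
    by (simp add: mult_left_mono)
  also have "\<dots> = (\<Prod>i\<in>insert j I. (\<Sum>k\<in>Pi\<^sub>E (insert j I) (\<lambda>_. S). D i k) powr (1 / d))"
  proof -
    have "sum G ?X = (\<Sum>k\<in>Pi\<^sub>E (insert j I) (\<lambda>_. S). D j k)"
      unfolding G_def sum_PiE_insert[OF insert.hyps(2)] by (rule sum.swap)
    moreover have "(\<Sum>s\<in>S. \<Sum>k\<in>?X. E s i k) = (\<Sum>k\<in>Pi\<^sub>E (insert j I) (\<lambda>_. S). D i k)" for i
      unfolding E_def sum_PiE_insert[OF insert.hyps(2)] ..
    ultimately show ?thesis using insert.hyps by simp
  qed
  finally show ?case unfolding d .
qed

lemma telescoping_bound:
  fixes a b :: "int \<Rightarrow> real"
  assumes "\<And>t. a t \<le> a (t + 1) + b t" "\<And>t. 0 \<le> b t" "a (N + 1) = 0" "s \<in> {M..N}"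
  shows "a s \<le> sum b {M..N}"
proof -
  have "a s \<le> sum b {s..N}" if "s \<le> N + 1" for s
    using that
  proof (induction rule: int_le_induct)
    case base
    then show ?case using assms by simp
  next
    case (step i)
    have "{i - 1..N} = insert (i - 1) {i..N}" using step by auto
    then show ?case using step assms(1)[of "i - 1"] by simp
  qed
  from this[of s] have "a s \<le> sum b {s..N}" using assms by simp
  also have "\<dots> \<le> sum b {M..N}" using assms by (intro sum_mono2) auto
  finally show ?thesis .
qed

text \<open>
Walking from \<open>k\<close> in the positive direction \<open>i\<close> until \<open>w\<close> vanishes bounds \<open>w k\<close> by the sum of \<open>D i\<close>
over the whole line. As this holds for every \<open>i\<close>, the power \<open>w k powr (d / (d - 1))\<close> is at most the
product of the \<open>d\<close> line sums to the power \<open>1 / (d - 1)\<close>, which Loomis-Whitney can sum. Only an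
upper bound for the decrease of \<open>w\<close> in positive directions enters, so \<open>w\<close> may jump up from \<open>0\<close> where
a walk enters the domain.
\<close>
lemma lattice_Gagliardo_Nirenberg:
  fixes w :: "('i \<Rightarrow> int) \<Rightarrow> real" and D :: "'i \<Rightarrow> ('i \<Rightarrow> int) \<Rightarrow> real"
  assumes I: "finite I" "2 \<le> card I"
    and w0: "\<And>k. 0 \<le> w k" and D0: "\<And>i k. 0 \<le> D i k"
    and supp: "\<And>k. k \<notin> Pi\<^sub>E I (\<lambda>_. {M..N}) \<Longrightarrow> w k = 0"
    and step: "\<And>i k. i \<in> I \<Longrightarrow> w k \<le> w (k(i := k i + 1)) + D i k"
  shows "(\<Sum>k\<in>Pi\<^sub>E I (\<lambda>_. {M..N}). w k powr (card I / (real (card I) - 1))) powr ((real (card I) - 1) / card I)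
     \<le> (\<Prod>i\<in>I. (\<Sum>k\<in>Pi\<^sub>E I (\<lambda>_. {M..N}). D i k) powr (1 / card I))"
proof -
  define d where "d = real (card I)"
  have d: "d \<ge> 2" using I by (simp add: d_def)
  let ?X = "Pi\<^sub>E I (\<lambda>_. {M..N})"
  have line: "w k \<le> (\<Sum>s\<in>{M..N}. D i (k(i := s)))" if "k \<in> ?X" "i \<in> I" for k i
  proof -
    have "w (k(i := k i)) \<le> (\<Sum>s\<in>{M..N}. D i (k(i := s)))"
    proof (rule telescoping_bound)
      show "w (k(i := t)) \<le> w (k(i := t + 1)) + D i (k(i := t))" for t
        using step[OF that(2), of "k(i := t)"] by simp
      show "w (k(i := N + 1)) = 0" using that by (intro supp) (auto simp: PiE_iff)
      show "k i \<in> {M..N}" using that by (auto simp: PiE_iff)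
    qed (use D0 in auto)
    then show ?thesis by simp
  qed
  have "(\<Sum>k\<in>?X. w k powr (d / (d - 1)))
     \<le> (\<Sum>k\<in>?X. \<Prod>i\<in>I. (\<Sum>s\<in>{M..N}. D i (k(i := s))) powr (1 / (d - 1)))"
  proof (rule sum_mono)
    fix k assume k: "k \<in> ?X"
    have "w k powr (d / (d - 1)) = (\<Prod>i\<in>I. w k powr (1 / (d - 1)))"
      using d I by (subst prod_constant, subst powr_power_pos) (auto simp: d_def)
    also have "\<dots> \<le> (\<Prod>i\<in>I. (\<Sum>s\<in>{M..N}. D i (k(i := s))) powr (1 / (d - 1)))"
      using k line w0 d by (intro prod_mono conjI powr_mono2) auto
    finally show "w k powr (d / (d - 1)) \<le> (\<Prod>i\<in>I. (\<Sum>s\<in>{M..N}. D i (k(i := s))) powr (1 / (d - 1)))" .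
  qed
  also have "\<dots> \<le> (\<Prod>i\<in>I. (\<Sum>k\<in>?X. D i k) powr (1 / (d - 1)))"
    unfolding d_def by (intro Loomis_Whitney I D0) auto
  finally have "(\<Sum>k\<in>?X. w k powr (d / (d - 1))) powr ((d - 1) / d)
     \<le> (\<Prod>i\<in>I. (\<Sum>k\<in>?X. D i k) powr (1 / (d - 1))) powr ((d - 1) / d)"
    using d by (intro powr_mono2) (auto intro!: sum_nonneg)
  also have "\<dots> = (\<Prod>i\<in>I. (\<Sum>k\<in>?X. D i k) powr (1 / d))"
    using d by (subst prod_powr_distrib) (auto simp: powr_powr)
  finally show ?thesis by (simp add: d_def)
qed

text \<open>
Apply the case of exponent one to the power \<open>w powr s\<close>. By the tangent inequality its decrease is
at most \<open>s * D * w powr (s - 1)\<close>, and Hoelder's inequality separates \<open>D\<close> from the power of \<open>w\<close>.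
\<close>
lemma lattice_Sobolev:
  fixes w :: "('i \<Rightarrow> int) \<Rightarrow> real" and D :: "'i \<Rightarrow> ('i \<Rightarrow> int) \<Rightarrow> real" and p :: real
  assumes I: "finite I" and p: "1 \<le> p" "p < real (card I)"
    and w0: "\<And>k. 0 \<le> w k" and D0: "\<And>i k. 0 \<le> D i k"
    and supp: "\<And>k. k \<notin> Pi\<^sub>E I (\<lambda>_. {M..N}) \<Longrightarrow> w k = 0"
    and step: "\<And>i k. i \<in> I \<Longrightarrow> w k \<le> w (k(i := k i + 1)) + D i k"
    and B: "\<And>i. i \<in> I \<Longrightarrow> (\<Sum>k\<in>Pi\<^sub>E I (\<lambda>_. {M..N}). D i k powr p) \<le> B"
  shows "(\<Sum>k\<in>Pi\<^sub>E I (\<lambda>_. {M..N}). w k powr (card I * p / (card I - p)))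
     \<le> (p * (real (card I) - 1) / (real (card I) - p) * B powr (1/p)) powr (card I * p / (card I - p))"
proof -
  define d where "d = real (card I)"
  \<comment> \<open>This choice makes \<open>s * (d / (d - 1))\<close> and (for \<open>1 < p\<close>) \<open>(s - 1) * (p / (p - 1))\<close> both equal
    to the Sobolev exponent \<open>r\<close>, so that the same sum \<open>W\<close> appears on both sides and can be absorbed.\<close>
  define s where "s = p * (d - 1) / (d - p)"
  define r where "r = d * p / (d - p)"
  let ?X = "Pi\<^sub>E I (\<lambda>_. {M..N})"
  have d: "d > p" "d \<ge> 2" "card I \<ge> 2" using p by (auto simp: d_def)
  have s1: "s \<ge> 1" using p d by (simp add: s_def field_simps)
  have r: "r > 0" using p d by (simp add: r_def)
  have fin: "finite ?X" using I by (simp add: finite_PiE)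
  have "I \<noteq> {}" using d by auto
  have B0: "B \<ge> 0"
  proof -
    obtain i where "i \<in> I" using \<open>I \<noteq> {}\<close> by auto
    have "0 \<le> (\<Sum>k\<in>?X. D i k powr p)" by (intro sum_nonneg) auto
    also have "\<dots> \<le> B" by (rule B[OF \<open>i \<in> I\<close>])
    finally show ?thesis .
  qed
  define W where "W = (\<Sum>k\<in>?X. w k powr r)"
  have W0: "W \<ge> 0" unfolding W_def by (intro sum_nonneg) auto
  define E where "E i k = s * D i k * w k powr (s - 1)" for i k
  have GN: "(\<Sum>k\<in>?X. (w k powr s) powr (d / (d - 1))) powr ((d - 1) / d)
       \<le> (\<Prod>i\<in>I. (\<Sum>k\<in>?X. E i k) powr (1 / d))"
    unfolding d_def
  proof (rule lattice_Gagliardo_Nirenberg)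
    show "w k powr s \<le> w (k(i := k i + 1)) powr s + E i k" if "i \<in> I" for i k
    proof -
      have "w k powr s - w (k(i := k i + 1)) powr s
          \<le> s * (w k - w (k(i := k i + 1))) * w k powr (s - 1)"
        by (intro powr_tangent w0 s1)
      also have "\<dots> \<le> E i k"
        unfolding E_def using step[OF that, of k] s1 by (intro mult_right_mono mult_left_mono) auto
      finally show ?thesis by simp
    qed
    show "0 \<le> E i k" for i k using s1 D0 by (simp add: E_def)
    show "w k powr s = 0" if "k \<notin> ?X" for k using supp[OF that] by simp
  qed (use I d in auto)
  have sd: "s * (d / (d - 1)) = r" using d p by (simp add: s_def r_def)
  have E: "(\<Sum>k\<in>?X. E i k) \<le> s * B powr (1/p) * W powr (1 - 1/p)" if "i \<in> I" for i
  proof -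
    have "(\<Sum>k\<in>?X. D i k * w k powr (s - 1)) \<le> B powr (1/p) * W powr (1 - 1/p)"
    proof (cases "p = 1")
      case True
      then have s: "s = 1" using d by (simp add: s_def)
      have "(\<Sum>k\<in>?X. D i k * w k powr (s - 1)) \<le> (if W = 0 then 0 else B)"
      proof (cases "W = 0")
        case True
        then have "\<forall>k\<in>?X. w k = 0"
          unfolding W_def using fin by (auto simp: sum_nonneg_eq_0_iff)
        then show ?thesis using \<open>W = 0\<close> by simp
      next
        case False
        have "(\<Sum>k\<in>?X. D i k * w k powr (s - 1)) \<le> (\<Sum>k\<in>?X. D i k powr p)"
          using True D0 by (intro sum_mono) (auto simp: s mult_left_le)
        also have "\<dots> \<le> B" by (rule B[OF that])
        finally show ?thesis using False by simp
      qed
      then show ?thesis using True B0 by (auto split: if_splits)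
    next
      case False
      then have p1: "p > 1" using p by simp
      have e: "(s - 1) = r * (1 - 1/p)"
        using p d by (simp add: s_def r_def field_simps)
      have "(\<Sum>k\<in>?X. (D i k powr p) powr (1/p) * (w k powr r) powr (1 - 1/p))
         \<le> (\<Sum>k\<in>?X. D i k powr p) powr (1/p) * W powr (1 - 1/p)"
        unfolding W_def using p1 by (intro sum_powr_Hoelder fin) auto
      also have "\<dots> \<le> B powr (1/p) * W powr (1 - 1/p)"
        using B[OF that] p1 by (intro mult_right_mono powr_mono2) (auto intro!: sum_nonneg)
      finally show ?thesis using p1 D0 by (simp add: powr_powr e)
    qed
    then have "s * (\<Sum>k\<in>?X. D i k * w k powr (s - 1)) \<le> s * (B powr (1/p) * W powr (1 - 1/p))"
      using s1 by (intro mult_left_mono) auto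
    then show ?thesis by (simp add: E_def sum_distrib_left mult.assoc)
  qed
  have "W powr ((d - 1) / d) \<le> (\<Prod>i\<in>I. (\<Sum>k\<in>?X. E i k) powr (1 / d))"
    using GN by (simp only: powr_powr sd W_def)
  also have "\<dots> \<le> (\<Prod>i\<in>I. (s * B powr (1/p) * W powr (1 - 1/p)) powr (1 / d))"
    using E d D0 s1 by (intro prod_mono conjI powr_mono2) (auto simp: E_def intro!: sum_nonneg)
  also have "\<dots> = (s * B powr (1/p) * W powr (1 - 1/p)) powr (1 / d * d)"
    using d by (subst prod_constant, subst powr_power_pos) (auto simp: d_def)
  also have "\<dots> = s * B powr (1/p) * W powr (1 - 1/p)"
    using d s1 by (simp)
  finally have main: "W powr ((d - 1) / d) \<le> s * B powr (1/p) * W powr (1 - 1/p)" .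
  have "W \<le> (s * B powr (1/p)) powr r"
  proof (cases "W = 0")
    case True then show ?thesis by simp
  next
    case False
    then have Wp: "W > 0" using W0 by simp
    have "(d - 1) / d = (1 - 1/p) + 1/r" using d p by (simp add: r_def field_simps)
    then have "W powr (1/r) * W powr (1 - 1/p) \<le> s * B powr (1/p) * W powr (1 - 1/p)"
      using main by (metis powr_add add.commute)
    then have "W powr (1/r) \<le> s * B powr (1/p)" using Wp by simp
    then have "(W powr (1/r)) powr r \<le> (s * B powr (1/p)) powr r"
      using r by (intro powr_mono2) auto
    then show ?thesis using r Wp by (simp add: powr_powr)
  qed
  then show ?thesis by (simp add: W_def r_def s_def d_def)
qed

section \<open>Cones and grids in Lipschitz domains\<close>

text \<open>
Below the graph of an \<open>L\<close>-Lipschitz function one may move in every direction close to the downward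
vertical: the vertical drop beats the change of the function along the horizontal part. At interior
points any direction will do. This is the form in which the regularity of the boundary is used.
\<close>
lemma lipschitz_boundary_local_cone:
  fixes \<Omega> :: "'a::euclidean_space set"
  assumes "open \<Omega>" "lipschitz_boundary \<Omega>" "z \<in> closure \<Omega>"
  obtains e \<delta> R where "norm e = 1" "0 < \<delta>" "0 < R"
    "\<And>x v s. \<lbrakk>x \<in> \<Omega>; x \<in> ball z R; norm (v - e) < \<delta>; 0 \<le> s; x + s *\<^sub>R v \<in> ball z R\<rbrakk> \<Longrightarrow> x + s *\<^sub>R v \<in> \<Omega>"
proof (cases "z \<in> \<Omega>")
  case True
  then obtain R where R: "R > 0" "ball z R \<subseteq> \<Omega>"
    using \<open>open \<Omega>\<close> open_contains_ball by blast
  show ?thesis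
  proof (rule that[of "SOME b. b \<in> Basis" 1 R])
    show "norm (SOME b::'a. b \<in> Basis) = 1" by (simp add: SOME_Basis)
  qed (use R in auto)
next
  case False
  then have "z \<in> frontier \<Omega>"
    using assms by (simp add: frontier_def interior_open)
  then obtain e g L U where e: "norm e = 1" and g: "L-lipschitz_on {v. v \<bullet> e = 0} g"
    and U: "open U" "z \<in> U" and graph: "\<Omega> \<inter> U = {y \<in> U. y \<bullet> e < (g (y - (y \<bullet> e) *\<^sub>R e) :: real)}"
    using assms(2) unfolding lipschitz_boundary_def by meson
  obtain R where R: "R > 0" "ball z R \<subseteq> U" using U open_contains_ball by blast
  have L: "L \<ge> 0" using g by (rule lipschitz_on_nonneg)
  have ee: "e \<bullet> e = 1" using e by (simp add: dot_square_norm)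
  show ?thesis
  proof (rule that[of "- e" "1 / (2 * L + 1)" R])
    fix x v s
    assume x: "x \<in> \<Omega>" "x \<in> ball z R" and v: "norm (v - - e) < 1 / (2 * L + 1)"
      and s: "0 \<le> (s::real)" and y: "x + s *\<^sub>R v \<in> ball z R"
    define w where "w = v + e"
    have w: "norm w * (2 * L + 1) \<le> 1" using v L by (simp add: w_def field_simps)
    define y where "y = x + s *\<^sub>R v"
    have yx: "y = x + s *\<^sub>R w - s *\<^sub>R e" by (simp add: y_def w_def algebra_simps)
    define P where "P u = u - (u \<bullet> e) *\<^sub>R e" for u
    have P0: "P u \<in> {v. v \<bullet> e = 0}" for u by (simp add: P_def inner_diff_left ee)
    have we: "\<bar>w \<bullet> e\<bar> \<le> norm w" using Cauchy_Schwarz_ineq2[of w e] e by simp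
    have "P y - P x = s *\<^sub>R (w - (w \<bullet> e) *\<^sub>R e)"
      by (simp add: P_def yx inner_diff_left inner_add_left ee algebra_simps)
    then have "dist (P y) (P x) = s * norm (w - (w \<bullet> e) *\<^sub>R e)"
      using s by (simp add: dist_norm)
    also have "\<dots> \<le> s * (2 * norm w)"
      using norm_triangle_ineq4[of w "(w \<bullet> e) *\<^sub>R e"] we e s by (intro mult_left_mono) auto
    finally have "L * dist (P y) (P x) \<le> L * (s * (2 * norm w))"
      using L by (intro mult_left_mono)
    then have gg: "g (P x) - g (P y) \<le> L * (s * (2 * norm w))"
      using lipschitz_onD[OF g P0 P0, of y x] by (simp add: dist_real_def)
    have "x \<in> \<Omega> \<inter> U" using x R by auto
    then have "x \<bullet> e < g (P x)" unfolding graph P_def by simp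
    moreover have "y \<bullet> e = x \<bullet> e + s * (w \<bullet> e) - s"
      by (simp add: yx inner_diff_left inner_add_left ee)
    moreover have "s * (w \<bullet> e) \<le> s * norm w" using we s by (intro mult_left_mono) auto
    moreover have "s * (norm w * (2 * L + 1)) \<le> s * 1" using w s by (intro mult_left_mono) auto
    ultimately have "y \<bullet> e < g (P y)" using gg by (simp add: algebra_simps)
    then have "y \<in> \<Omega> \<inter> U" unfolding graph using y R by (auto simp: y_def P_def)
    then show "x + s *\<^sub>R v \<in> \<Omega>" by (simp add: y_def)
  qed (use e L R in auto)
qed

text \<open>
A partition of the space into parallelepipeds of mesh \<open>h\<close> whose edge directions \<open>v b\<close> are close
to a given unit vector \<open>e\<close>; \<open>\<kappa> h x\<close> is the index of the cell of \<open>x\<close>. The edges are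
\<open>e + \<tau> *\<^sub>R b\<close> for the standard basis vectors \<open>b\<close>. This is a basis for all positive
\<open>\<tau>\<close> but at most one, and the change of coordinates is explicit in both directions.
\<close>
lemma slanted_grid:
  fixes e :: "'a::euclidean_space"
  assumes "norm e = 1" "0 < \<delta>"
  obtains v :: "'a \<Rightarrow> 'a" and \<kappa> :: "real \<Rightarrow> 'a \<Rightarrow> 'a \<Rightarrow> int" and C \<rho>
  where "0 < C" "0 < \<rho>" "\<And>b. b \<in> Basis \<Longrightarrow> norm (v b - e) < \<delta>"
    "\<And>h x. \<kappa> h x \<in> extensional Basis"
    "\<And>h x b. 0 < h \<Longrightarrow> b \<in> Basis \<Longrightarrow> \<kappa> h (x + h *\<^sub>R v b) = (\<kappa> h x)(b := \<kappa> h x b + 1)"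
    "\<And>h x y. 0 < h \<Longrightarrow> \<kappa> h x = \<kappa> h y \<Longrightarrow> dist x y \<le> C * h"
    "\<And>h x. 0 < h \<Longrightarrow> \<exists>c. ball c (\<rho> * h) \<subseteq> {y. \<kappa> h y = \<kappa> h x}"
proof -
  \<comment> \<open>The determinant of the vectors \<open>e + \<tau> *\<^sub>R b\<close> is \<open>\<tau> ^ (d - 1) * (\<tau> + e \<bullet> One)\<close>.\<close>
  obtain \<tau> where \<tau>: "0 < \<tau>" "\<tau> < \<delta>" "\<tau> + e \<bullet> One \<noteq> 0"
  proof (cases "\<delta> / 2 + e \<bullet> One = 0")
    case True
    then show ?thesis using that[of "\<delta> / 4"] assms by simp
  next
    case False
    then show ?thesis using that[of "\<delta> / 2"] assms by simp
  qed
  define \<sigma> where "\<sigma> = \<tau> + e \<bullet> One"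
  have \<sigma>: "\<sigma> \<noteq> 0" using \<tau> by (simp add: \<sigma>_def)
  \<comment> \<open>\<open>A\<close> maps the standard basis to the slanted one, and \<open>L\<close> is its inverse.\<close>
  define A where "A y = \<tau> *\<^sub>R y + (y \<bullet> One) *\<^sub>R e" for y :: 'a
  define L where "L x = (1/\<tau>) *\<^sub>R (x - ((x \<bullet> One) / \<sigma>) *\<^sub>R e)" for x :: 'a
  have LA: "L (A y) = y" for y
  proof -
    have "A y \<bullet> One = (y \<bullet> One) * \<sigma>" by (simp add: A_def \<sigma>_def inner_add_left algebra_simps)
    then show ?thesis using \<tau> \<sigma> by (simp add: L_def A_def)
  qed
  have AL: "A (L x) = x" for x
  proof -
    have "(L x) \<bullet> One = (x \<bullet> One) / \<sigma>"
    proof -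
      have "(L x) \<bullet> One = (1/\<tau>) * ((x \<bullet> One) - ((x \<bullet> One) / \<sigma>) * (e \<bullet> One))"
        by (simp add: L_def inner_diff_left)
      also have "\<dots> = (1/\<tau>) * ((x \<bullet> One) * (\<sigma> - e \<bullet> One) / \<sigma>)"
        using \<sigma> by (simp add: field_simps)
      also have "\<dots> = (x \<bullet> One) / \<sigma>" using \<tau> by (simp add: \<sigma>_def)
      finally show ?thesis .
    qed
    then show ?thesis using \<tau> by (simp add: A_def) (simp add: L_def)
  qed
  have blL: "bounded_linear L"
    unfolding L_def
    by (intro bounded_linear_const_scaleR[THEN bounded_linear_compose] bounded_linear_sub
        bounded_linear_ident bounded_linear_scaleR_const bounded_linear_divide[THEN bounded_linear_compose]
        bounded_linear_inner_left bounded_linear_scaleR_right)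
  interpret L: bounded_linear L by (rule blL)
  obtain B where B: "B > 0" "\<And>x. norm (L x) \<le> norm x * B"
    using L.pos_bounded by blast
  have Ldiff: "L (x - y) = L x - L y" for x y by (rule L.diff)
  define \<kappa> where "\<kappa> h x = (\<lambda>b\<in>Basis. \<lfloor>(L x \<bullet> b) / h\<rfloor>)" for h x
  define v where "v b = e + \<tau> *\<^sub>R b" for b :: 'a
  have Lv: "L (v b) = b" if "b \<in> Basis" for b
  proof -
    have "A b = v b" using that by (simp add: A_def v_def inner_sum_right inner_Basis add.commute)
    then show ?thesis using LA[of b] by simp
  qed
  define C where "C = (\<tau> + norm (One::'a)) * DIM('a)"
  show ?thesis
  proof (rule that[of C "1 / (2 * B)" v \<kappa>])
    show "0 < C" using \<tau> by (auto simp: C_def intro!: mult_pos_pos add_pos_nonneg)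
    show "0 < 1 / (2 * B)" using B by simp
    show "norm (v b - e) < \<delta>" if "b \<in> Basis" for b using that \<tau> by (simp add: v_def)
    show "\<kappa> h x \<in> extensional Basis" for h x by (simp add: \<kappa>_def)
    show "\<kappa> h (x + h *\<^sub>R v b) = (\<kappa> h x)(b := \<kappa> h x b + 1)" if h: "0 < h" and b: "b \<in> Basis" for h x b
    proof
      fix c
      have "L (x + h *\<^sub>R v b) = L x + h *\<^sub>R b" using Lv[OF b] by (simp add: L.add L.scaleR)
      then have "\<kappa> h (x + h *\<^sub>R v b) c = (if c \<in> Basis then \<lfloor>(L x \<bullet> c) / h + b \<bullet> c\<rfloor> else undefined)"
        using h by (simp add: \<kappa>_def inner_add_left add_divide_distrib)
      then show "\<kappa> h (x + h *\<^sub>R v b) c = ((\<kappa> h x)(b := \<kappa> h x b + 1)) c"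
        using b by (auto simp: \<kappa>_def inner_Basis)
    qed
    show "dist x y \<le> C * h" if h: "0 < h" and eq: "\<kappa> h x = \<kappa> h y" for h x y
    proof -
      have "\<bar>L (x - y) \<bullet> b\<bar> \<le> h" if b: "b \<in> Basis" for b
      proof -
        have "\<lfloor>(L x \<bullet> b) / h\<rfloor> = \<lfloor>(L y \<bullet> b) / h\<rfloor>"
          using fun_cong[OF eq, of b] b by (simp add: \<kappa>_def)
        then have "\<bar>(L x \<bullet> b) / h - (L y \<bullet> b) / h\<bar> \<le> 1" by linarith
        then have "\<bar>(L x \<bullet> b) - (L y \<bullet> b)\<bar> / h \<le> 1"
          using h by (simp add: diff_divide_distrib[symmetric])
        then show ?thesis using h by (simp add: Ldiff inner_diff_left)
      qed
      then have "norm (L (x - y)) \<le> (\<Sum>b::'a\<in>Basis. h)"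
        using norm_le_l1[of "L (x - y)"] by (meson order_trans sum_mono)
      then have n: "norm (L (x - y)) \<le> DIM('a) * h" by simp
      have "norm (A u) \<le> (\<tau> + norm (One::'a)) * norm u" for u
      proof -
        have "norm (A u) \<le> norm (\<tau> *\<^sub>R u) + norm ((u \<bullet> One) *\<^sub>R e)"
          unfolding A_def by (rule norm_triangle_ineq)
        also have "\<dots> = \<tau> * norm u + \<bar>u \<bullet> One\<bar>" using \<tau> assms by simp
        also have "\<bar>u \<bullet> One\<bar> \<le> norm u * norm (One::'a)" by (rule Cauchy_Schwarz_ineq2)
        finally show ?thesis by (simp add: algebra_simps)
      qed
      from this[of "L (x - y)"] have "norm (x - y) \<le> (\<tau> + norm (One::'a)) * norm (L (x - y))"
        by (simp add: AL)
      also have "\<dots> \<le> (\<tau> + norm (One::'a)) * (DIM('a) * h)"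
        using n \<tau> by (intro mult_left_mono add_nonneg_nonneg) auto
      finally show ?thesis by (simp add: C_def dist_norm mult.assoc)
    qed
    show "\<exists>c. ball c (1 / (2 * B) * h) \<subseteq> {y. \<kappa> h y = \<kappa> h x}" if h: "0 < h" for h x
    proof (intro exI subsetI CollectI)
      let ?k = "\<kappa> h x"
      let ?c = "\<Sum>b\<in>Basis. (h * (of_int (?k b) + 1/2)) *\<^sub>R b"
      fix y assume y: "y \<in> ball (A ?c) (1 / (2 * B) * h)"
      show "\<kappa> h y = ?k"
      proof
        fix b
        show "\<kappa> h y b = ?k b"
        proof (cases "b \<in> Basis")
          case False
          then show ?thesis by (simp add: \<kappa>_def)
        next
          case b: True
          have "norm (L (A ?c - y)) \<le> norm (A ?c - y) * B" by (rule B)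
          also have "\<dots> < (1 / (2 * B) * h) * B" using y B by (intro mult_strict_right_mono) (auto simp: dist_norm)
          also have "\<dots> = h / 2" using B by simp
          finally have "\<bar>(?c - L y) \<bullet> b\<bar> < h / 2"
            using Basis_le_norm[OF b, of "?c - L y"] by (simp add: Ldiff LA)
          then have "\<bar>h * (of_int (?k b) + 1/2) - L y \<bullet> b\<bar> < h / 2"
            using b by (simp add: inner_diff_left)
          then have "of_int (?k b) * h \<le> L y \<bullet> b" "L y \<bullet> b < (of_int (?k b) + 1) * h"
            unfolding abs_less_iff by (simp_all add: algebra_simps)
          then have "\<lfloor>(L y \<bullet> b) / h\<rfloor> = ?k b"
            using h by (intro floor_unique) (simp_all add: field_simps)
          then show ?thesis using b by (simp add: \<kappa>_def)
        qed
      qed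
    qed
  qed
qed

section \<open>From weighted points to the lattice\<close>

text \<open>
Jensen's inequality for the product weight, applied to the difference of the two means written as
one mean over pairs.
\<close>
lemma powr_diff_weighted_means_le:
  fixes m F :: "'b \<Rightarrow> real"
  assumes "finite A" "finite B" "\<And>x. x \<in> A \<union> B \<Longrightarrow> 0 \<le> m x" "0 < sum m A" "0 < sum m B" "1 \<le> p"
  shows "\<bar>(\<Sum>x\<in>A. m x * F x) / sum m A - (\<Sum>y\<in>B. m y * F y) / sum m B\<bar> powr p
     \<le> (\<Sum>x\<in>A. \<Sum>y\<in>B. m x * m y * \<bar>F x - F y\<bar> powr p) / (sum m A * sum m B)"
proof -
  let ?m = "\<lambda>(x, y). m x * m y" and ?a = "\<lambda>(x, y). \<bar>F x - F y\<bar>"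
  have M: "sum ?m (A \<times> B) = sum m A * sum m B"
    by (simp add: sum_product sum.cartesian_product)
  have "(\<Sum>x\<in>A. m x * F x) * sum m B - (\<Sum>y\<in>B. m y * F y) * sum m A
      = (\<Sum>x\<in>A. \<Sum>y\<in>B. m x * m y * (F x - F y))"
  proof -
    have "(\<Sum>x\<in>A. m x * F x) * sum m B = (\<Sum>x\<in>A. \<Sum>y\<in>B. m x * m y * F x)"
      unfolding sum_product by (simp add: mult_ac)
    moreover have "sum m A * (\<Sum>y\<in>B. m y * F y) = (\<Sum>x\<in>A. \<Sum>y\<in>B. m x * m y * F y)"
      unfolding sum_product by (simp add: mult_ac)
    ultimately show ?thesis
      by (simp add: mult.commute[of _ "sum m A"] right_diff_distrib sum_subtractf)
  qed
  then have "(\<Sum>x\<in>A. m x * F x) / sum m A - (\<Sum>y\<in>B. m y * F y) / sum m B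
     = (\<Sum>x\<in>A. \<Sum>y\<in>B. m x * m y * (F x - F y)) / (sum m A * sum m B)"
    using assms by (simp add: field_simps)
  also have "\<bar>\<dots>\<bar> \<le> (\<Sum>z\<in>A \<times> B. ?m z * ?a z) / (sum m A * sum m B)"
  proof -
    have "\<bar>\<Sum>x\<in>A. \<Sum>y\<in>B. m x * m y * (F x - F y)\<bar> \<le> (\<Sum>x\<in>A. \<Sum>y\<in>B. m x * m y * \<bar>F x - F y\<bar>)"
      by (intro order_trans[OF sum_abs] sum_mono) (simp add: abs_mult assms)
    then show ?thesis using assms
      by (simp add: sum.cartesian_product case_prod_unfold divide_right_mono)
  qed
  finally have "\<bar>(\<Sum>x\<in>A. m x * F x) / sum m A - (\<Sum>y\<in>B. m y * F y) / sum m B\<bar> powr p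
     \<le> ((\<Sum>z\<in>A \<times> B. ?m z * ?a z) / sum ?m (A \<times> B)) powr p"
    using assms unfolding M by (intro powr_mono2) auto
  also have "\<dots> \<le> (\<Sum>z\<in>A \<times> B. ?m z * ?a z powr p) / sum ?m (A \<times> B)"
    by (intro powr_weighted_mean_le) (use assms M in auto)
  also have "\<dots> = (\<Sum>x\<in>A. \<Sum>y\<in>B. m x * m y * \<bar>F x - F y\<bar> powr p) / (sum m A * sum m B)"
    unfolding M by (simp add: sum.cartesian_product case_prod_unfold)
  finally show ?thesis .
qed

text \<open>
For \<open>w \<le> n\<close> the first summand dominates, for \<open>n \<le> w\<close> the second. Summed with \<open>n\<close> the size of the
function, this passes from the exponents \<open>p\<close> and \<open>r\<close> to those in between, in homogeneous form.
\<close>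
lemma powr_interpolation:
  fixes w n p q r :: real
  assumes "0 \<le> w" "0 < n" "p \<le> q" "q \<le> r"
  shows "w powr q \<le> n powr (q - p) * w powr p + n powr (q - r) * w powr r"
proof (cases "w = 0")
  case True then show ?thesis by simp
next
  case False
  then have w: "w > 0" using assms by simp
  show ?thesis
  proof (cases "w \<le> n")
    case True
    have "w powr q = w powr (q - p) * w powr p" using w by (simp flip: powr_add)
    also have "\<dots> \<le> n powr (q - p) * w powr p"
      using True w assms by (intro mult_right_mono powr_mono2) auto
    finally show ?thesis by (simp add: add_increasing2)
  next
    case False
    have "w powr q = w powr (q - r) * w powr r" using w by (simp flip: powr_add)
    also have "\<dots> \<le> n powr (q - r) * w powr r"
      using False w assms by (intro mult_right_mono powr_mono2') auto
    finally show ?thesis by (simp add: add_increasing)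
  qed
qed

text \<open>
The comparison of weighted points with the lattice, stripped of all geometry. The points of \<open>V\<close> are
sorted into cells by \<open>\<kappa>\<close>; \<open>G\<close> is the set of cells that are heavy enough to be averaged over, and
\<open>up\<close> says that a positive step out of such a cell leads to another one unless \<open>F\<close> vanishes on the
cell. The averages of \<open>F\<close> over the cells in \<open>G\<close>, extended by \<open>0\<close>, then satisfy the one-sided
hypothesis of the lattice inequality. The resulting \<open>v\<close> assigns to a point the average over the cell
\<open>\<kappa>' x\<close>, which may differ from its own cell.
\<close>
lemma cell_average_Sobolev:
  fixes V B :: "'b set" and m F :: "'b \<Rightarrow> real" and \<kappa> \<kappa>' :: "'b \<Rightarrow> 'i \<Rightarrow> int"
    and G :: "('i \<Rightarrow> int) set" and near :: "'b \<Rightarrow> 'b \<Rightarrow> bool" and p M M' P :: real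
  assumes I: "finite I" and p: "1 \<le> p" "p < real (card I)"
    and V: "finite V" "\<And>x. x \<in> V \<Longrightarrow> 0 < m x" "\<And>x. x \<in> V \<Longrightarrow> 0 \<le> F x"
    and ext: "\<And>x. x \<in> V \<Longrightarrow> \<kappa> x \<in> extensional I"
    and M: "0 < M" "\<And>k. k \<in> G \<Longrightarrow> M \<le> (\<Sum>x\<in>{x\<in>V. \<kappa> x = k}. m x)"
    and up: "\<And>i x. \<lbrakk>i \<in> I; x \<in> V; \<kappa> x \<in> G; F x \<noteq> 0\<rbrakk> \<Longrightarrow> (\<kappa> x)(i := \<kappa> x i + 1) \<in> G"
    and near: "\<And>i x y. \<lbrakk>i \<in> I; x \<in> V; y \<in> V; \<kappa> y = (\<kappa> x)(i := \<kappa> x i + 1)\<rbrakk> \<Longrightarrow> near x y"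
    and P: "(\<Sum>x\<in>V. \<Sum>y\<in>{y\<in>V. near x y}. m x * m y * \<bar>F x - F y\<bar> powr p) \<le> P"
    and B: "B \<subseteq> V" "\<And>x. x \<in> B \<Longrightarrow> \<kappa>' x \<in> G" "\<And>x y. \<lbrakk>x \<in> B; y \<in> V; \<kappa> y = \<kappa>' x\<rbrakk> \<Longrightarrow> near x y"
    and M': "\<And>k. (\<Sum>x\<in>{x\<in>B. \<kappa>' x = k}. m x) \<le> M'"
  obtains v where "\<And>x. 0 \<le> v x" "(\<Sum>x\<in>B. m x * \<bar>F x - v x\<bar> powr p) \<le> P / M"
    "\<And>q n. \<lbrakk>p \<le> q; q \<le> card I * p / (card I - p); 0 < n\<rbrakk> \<Longrightarrow>
       (\<Sum>x\<in>B. m x * v x powr q) \<le> M' * (n powr (q - p) * ((\<Sum>x\<in>V. m x * F x powr p) / M)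
          + n powr (q - card I * p / (card I - p)) *
            (p * (real (card I) - 1) / (real (card I) - p) * (P / M\<^sup>2) powr (1/p)) powr (card I * p / (card I - p)))"
proof -
  define S where "S k = {x\<in>V. \<kappa> x = k}" for k
  have S: "finite (S k)" "S k \<subseteq> V" for k using V by (auto simp: S_def)
  have inS: "\<And>x k. x \<in> S k \<Longrightarrow> x \<in> V" by (simp add: S_def)
  have m0: "\<And>x. x \<in> V \<Longrightarrow> 0 \<le> m x" using V by (simp add: less_imp_le)
  have SM: "M \<le> sum m (S k)" "0 < sum m (S k)" if "k \<in> G" for k
    using M(2)[OF that] M(1) by (auto simp: S_def)
  define w where "w k = (if k \<in> G then (\<Sum>x\<in>S k. m x * F x) / sum m (S k) else 0)" for k
  have w0: "0 \<le> w k" for k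
    unfolding w_def using V S(1) m0 inS by (auto intro!: divide_nonneg_nonneg sum_nonneg mult_nonneg_nonneg)
  define D where "D i k = (if k \<in> G \<and> k(i := k i + 1) \<in> G then \<bar>w k - w (k(i := k i + 1))\<bar> else 0)" for i k
  define f where "f x y = m x * m y * \<bar>F x - F y\<bar> powr p" for x y
  have f0: "0 \<le> f x y" if "x \<in> V" "y \<in> V" for x y using that m0 by (simp add: f_def)
  \<comment> \<open>A bound for all coordinates of occupied cells, so that \<open>w\<close> vanishes outside the box \<open>?X\<close>.\<close>
  define N where "N = (\<Sum>x\<in>V. \<Sum>i\<in>I. \<bar>\<kappa> x i\<bar>)"
  let ?X = "Pi\<^sub>E I (\<lambda>_. {-N..N})"
  have fin: "finite ?X" using I by (simp add: finite_PiE)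
  have \<kappa>X: "\<kappa> x \<in> ?X" if "x \<in> V" for x
  proof -
    have "\<bar>\<kappa> x i\<bar> \<le> N" if "i \<in> I" for i
    proof -
      have "\<bar>\<kappa> x i\<bar> \<le> (\<Sum>i\<in>I. \<bar>\<kappa> x i\<bar>)" using that I by (intro member_le_sum) auto
      also have "\<dots> \<le> N" unfolding N_def
        using \<open>x \<in> V\<close> V by (intro member_le_sum[where f="\<lambda>x. \<Sum>i\<in>I. \<bar>\<kappa> x i\<bar>"]) (auto intro!: sum_nonneg)
      finally show ?thesis .
    qed
    then have "\<forall>i\<in>I. \<kappa> x i \<in> {-N..N}" by (meson abs_le_iff atLeastAtMost_iff minus_le_iff)
    then show ?thesis using ext[OF that] by (simp add: PiE_iff)
  qed
  have wX: "w k = 0" if "k \<notin> ?X" for k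
  proof -
    have "S k = {}" using that \<kappa>X by (auto simp: S_def)
    then show ?thesis by (simp add: w_def)
  qed
  have group: "(\<Sum>k\<in>?X. \<Sum>x\<in>S k. g k x) = (\<Sum>x\<in>V. g (\<kappa> x) x)" for g :: "_ \<Rightarrow> _ \<Rightarrow> real"
  proof -
    have "(\<Sum>k\<in>?X. \<Sum>x\<in>S k. g k x) = (\<Sum>k\<in>?X. \<Sum>x\<in>S k. g (\<kappa> x) x)"
      by (intro sum.cong refl) (auto simp: S_def)
    also have "\<dots> = (\<Sum>x\<in>V. g (\<kappa> x) x)"
      unfolding S_def using \<kappa>X by (intro sum.group V fin) auto
    finally show ?thesis .
  qed
  have P0: "0 \<le> P"
    using P m0 by (intro order_trans[OF _ P] sum_nonneg mult_nonneg_nonneg) auto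
  have step: "w k \<le> w (k(i := k i + 1)) + D i k" if "i \<in> I" for i k
  proof (cases "k \<in> G \<and> w k \<noteq> 0")
    case True
    then have "\<exists>x\<in>S k. F x \<noteq> 0" by (auto simp: w_def intro: ccontr)
    then obtain x where "x \<in> V" "\<kappa> x = k" "F x \<noteq> 0" by (auto simp: S_def)
    then have "k(i := k i + 1) \<in> G" using up[OF that, of x] True by auto
    then show ?thesis using True by (simp add: D_def)
  next
    case False
    then have "w k = 0" by (auto simp: w_def)
    then show ?thesis using w0[of "k(i := k i + 1)"] by (simp add: D_def)
  qed
  have DP: "(\<Sum>k\<in>?X. D i k powr p) \<le> P / M\<^sup>2" if i: "i \<in> I" for i
  proof -
    have "(\<Sum>k\<in>?X. D i k powr p) \<le> (\<Sum>k\<in>?X. (\<Sum>x\<in>S k. \<Sum>y\<in>S (k(i := k i + 1)). f x y) / M\<^sup>2)"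
    proof (rule sum_mono)
      fix k :: "'i \<Rightarrow> int"
      let ?l = "k(i := k i + 1)"
      show "D i k powr p \<le> (\<Sum>x\<in>S k. \<Sum>y\<in>S ?l. f x y) / M\<^sup>2"
      proof (cases "k \<in> G \<and> ?l \<in> G")
        case True
        then have "D i k powr p = \<bar>(\<Sum>x\<in>S k. m x * F x) / sum m (S k) - (\<Sum>y\<in>S ?l. m y * F y) / sum m (S ?l)\<bar> powr p"
          by (simp add: D_def w_def)
        also have "\<dots> \<le> (\<Sum>x\<in>S k. \<Sum>y\<in>S ?l. f x y) / (sum m (S k) * sum m (S ?l))"
          unfolding f_def by (intro powr_diff_weighted_means_le S SM p) (use True S(1) inS m0 in auto)
        also have "\<dots> \<le> (\<Sum>x\<in>S k. \<Sum>y\<in>S ?l. f x y) / M\<^sup>2"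
          unfolding power2_eq_square
          using True SM M(1) S(1) inS m0
          by (intro divide_left_mono mult_mono sum_nonneg f0 mult_pos_pos) (auto simp: less_imp_le)
        finally show ?thesis .
      next
        case False
        then show ?thesis using S(1) f0 inS
          by (auto simp: D_def intro!: divide_nonneg_nonneg sum_nonneg)
      qed
    qed
    also have "\<dots> = (\<Sum>x\<in>V. \<Sum>y\<in>S ((\<kappa> x)(i := \<kappa> x i + 1)). f x y) / M\<^sup>2"
      by (simp add: sum_divide_distrib[symmetric] group)
    also have "\<dots> \<le> (\<Sum>x\<in>V. \<Sum>y\<in>{y\<in>V. near x y}. f x y) / M\<^sup>2"
      using near[OF i] V f0
      by (intro divide_right_mono sum_mono sum_mono2) (auto simp: S_def)
    also have "\<dots> \<le> P / M\<^sup>2" using P by (intro divide_right_mono) (auto simp: f_def)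
    finally show ?thesis .
  qed
  define r where "r = card I * p / (card I - p)"
  define E where "E = (p * (real (card I) - 1) / (real (card I) - p) * (P / M\<^sup>2) powr (1/p)) powr r"
  have Wr: "(\<Sum>k\<in>?X. w k powr r) \<le> E"
    unfolding r_def E_def
    by (rule lattice_Sobolev[where D = D]) (use I p w0 wX step DP in \<open>auto simp: D_def\<close>)
  have Wp: "(\<Sum>k\<in>?X. w k powr p) \<le> (\<Sum>x\<in>V. m x * F x powr p) / M"
  proof -
    have "(\<Sum>k\<in>?X. w k powr p) \<le> (\<Sum>k\<in>?X. (\<Sum>x\<in>S k. m x * F x powr p) / M)"
    proof (rule sum_mono)
      fix k
      have nn: "0 \<le> (\<Sum>x\<in>S k. m x * F x powr p)" using S(1) m0 inS by (auto intro!: sum_nonneg)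
      show "w k powr p \<le> (\<Sum>x\<in>S k. m x * F x powr p) / M"
      proof (cases "k \<in> G")
        case True
        then have "w k powr p \<le> (\<Sum>x\<in>S k. m x * F x powr p) / sum m (S k)"
          unfolding w_def using S(1) inS m0 V SM(2)[OF True] p by (auto intro!: powr_weighted_mean_le)
        also have "\<dots> \<le> (\<Sum>x\<in>S k. m x * F x powr p) / M"
          using SM[OF True] M nn by (intro divide_left_mono) auto
        finally show ?thesis .
      next
        case False
        then show ?thesis using nn M by (simp add: w_def)
      qed
    qed
    then show ?thesis by (simp add: sum_divide_distrib[symmetric] group)
  qed
  show ?thesis
  proof (rule that[of "\<lambda>x. w (\<kappa>' x)"])
    show "0 \<le> w (\<kappa>' x)" for x by (rule w0)
    show "(\<Sum>x\<in>B. m x * \<bar>F x - w (\<kappa>' x)\<bar> powr p) \<le> P / M"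
    proof -
      have "(\<Sum>x\<in>B. m x * \<bar>F x - w (\<kappa>' x)\<bar> powr p) \<le> (\<Sum>x\<in>B. (\<Sum>y\<in>S (\<kappa>' x). f x y) / M)"
      proof (rule sum_mono)
        fix x assume x: "x \<in> B"
        have xV: "x \<in> V" using x B by auto
        have g: "\<kappa>' x \<in> G" using x B by auto
        have "\<bar>(\<Sum>x\<in>{x}. m x * F x) / sum m {x} - (\<Sum>y\<in>S (\<kappa>' x). m y * F y) / sum m (S (\<kappa>' x))\<bar> powr p
           \<le> (\<Sum>z\<in>{x}. \<Sum>y\<in>S (\<kappa>' x). m z * m y * \<bar>F z - F y\<bar> powr p) / (sum m {x} * sum m (S (\<kappa>' x)))"
          by (rule powr_diff_weighted_means_le) (use S(1) inS xV V(2) m0 SM[OF g] p in auto)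
        then have "m x * \<bar>F x - w (\<kappa>' x)\<bar> powr p \<le> m x * ((\<Sum>y\<in>S (\<kappa>' x). f x y) / (m x * sum m (S (\<kappa>' x))))"
          using V(2)[OF xV] g by (intro mult_left_mono) (auto simp: w_def f_def)
        also have "\<dots> = (\<Sum>y\<in>S (\<kappa>' x). f x y) / sum m (S (\<kappa>' x))"
          using V(2)[OF xV] by simp
        also have "\<dots> \<le> (\<Sum>y\<in>S (\<kappa>' x). f x y) / M"
          using SM[OF g] M(1) S(1) inS xV f0 by (intro divide_left_mono sum_nonneg) auto
        finally show "m x * \<bar>F x - w (\<kappa>' x)\<bar> powr p \<le> (\<Sum>y\<in>S (\<kappa>' x). f x y) / M" .
      qed
      also have "\<dots> = (\<Sum>x\<in>B. \<Sum>y\<in>S (\<kappa>' x). f x y) / M" by (simp add: sum_divide_distrib)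
      also have "(\<Sum>x\<in>B. \<Sum>y\<in>S (\<kappa>' x). f x y) \<le> (\<Sum>x\<in>B. \<Sum>y\<in>{y\<in>V. near x y}. f x y)"
        using B V f0 by (intro sum_mono sum_mono2) (auto simp: S_def)
      also have "\<dots> \<le> (\<Sum>x\<in>V. \<Sum>y\<in>{y\<in>V. near x y}. f x y)"
        using B V f0 by (intro sum_mono2 sum_nonneg) auto
      also have "\<dots> \<le> P" using P by (simp add: f_def)
      finally show ?thesis using M by (simp add: divide_right_mono)
    qed
    fix q n :: real
    assume q: "p \<le> q" "q \<le> card I * p / (card I - p)" and n: "0 < n"
    let ?T = "?X \<union> \<kappa>' ` B"
    have finB: "finite B" using B V finite_subset by blast
    have M'0: "0 \<le> M'"
      using M'[of undefined] B m0 by (intro order_trans[OF _ M'[of undefined]] sum_nonneg) auto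
    have "(\<Sum>x\<in>B. m x * w (\<kappa>' x) powr q) = (\<Sum>k\<in>?T. \<Sum>x\<in>{x\<in>B. \<kappa>' x = k}. m x * w (\<kappa>' x) powr q)"
      using finB fin by (intro sum.group[symmetric]) auto
    also have "\<dots> = (\<Sum>k\<in>?T. (\<Sum>x\<in>{x\<in>B. \<kappa>' x = k}. m x) * w k powr q)"
      by (intro sum.cong refl) (auto simp: sum_distrib_right)
    also have "\<dots> \<le> (\<Sum>k\<in>?T. M' * w k powr q)"
      by (intro sum_mono mult_right_mono M') auto
    also have "\<dots> = (\<Sum>k\<in>?X. M' * w k powr q)"
      using fin finB wX by (intro sum.mono_neutral_right) auto
    also have "\<dots> \<le> (\<Sum>k\<in>?X. M' * (n powr (q - p) * w k powr p + n powr (q - r) * w k powr r))"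
      using q n M'0 w0 by (intro sum_mono mult_left_mono powr_interpolation) (auto simp: r_def)
    also have "\<dots> = M' * (n powr (q - p) * (\<Sum>k\<in>?X. w k powr p) + n powr (q - r) * (\<Sum>k\<in>?X. w k powr r))"
      by (simp add: sum.distrib flip: sum_distrib_left)
    also have "\<dots> \<le> M' * (n powr (q - p) * ((\<Sum>x\<in>V. m x * F x powr p) / M) + n powr (q - r) * E)"
      using Wp Wr M'0 by (intro mult_left_mono add_mono) auto
    finally show "(\<Sum>x\<in>B. m x * w (\<kappa>' x) powr q) \<le> M' * (n powr (q - p) * ((\<Sum>x\<in>V. m x * F x powr p) / M)
          + n powr (q - card I * p / (card I - p)) *
            (p * (real (card I) - 1) / (real (card I) - p) * (P / M\<^sup>2) powr (1/p)) powr (card I * p / (card I - p)))"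
      unfolding E_def r_def .
  qed
qed

section \<open>Weighted graphs that are regular above a scale\<close>

text \<open>
The weights resemble Lebesgue measure on balls of radius at least \<open>s\<close>. The lower bound counts
the points in the doubled ball, since a map of displacement \<open>s\<close> carries \<open>ball c r\<close> only into a larger ball.
\<close>
definition ball_regular :: "'a::euclidean_space set \<Rightarrow> 'a set \<Rightarrow> ('a \<Rightarrow> real) \<Rightarrow> real \<Rightarrow> real \<Rightarrow> real \<Rightarrow> bool" where
  "ball_regular \<Omega> V m c\<^sub>1 c\<^sub>2 s \<longleftrightarrow>
     (\<forall>c r. s \<le> r \<longrightarrow> ball c r \<subseteq> \<Omega> \<longrightarrow> c\<^sub>1 * r ^ DIM('a) \<le> (\<Sum>y\<in>{y\<in>V. dist y c < 2 * r}. m y)) \<and>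
     (\<forall>c r. s \<le> r \<longrightarrow> (\<Sum>y\<in>{y\<in>V. dist y c \<le> r}. m y) \<le> c\<^sub>2 * r ^ DIM('a))"

definition short_range_energy :: "'a::euclidean_space set \<Rightarrow> ('a \<Rightarrow> real) \<Rightarrow> real \<Rightarrow> real \<Rightarrow> ('a \<Rightarrow> real) \<Rightarrow> real" where
  "short_range_energy V m l p u = (\<Sum>x\<in>V. \<Sum>y\<in>{y\<in>V. dist x y \<le> l}. m x * m y * \<bar>u x - u y\<bar> powr p)"

text \<open>
The \<open>p\<close>-th power of a nonlocal \<open>W\<^sup>1\<^sup>,\<^sup>p\<close> norm, in which the kernel is the indicator function of
\<open>[0, a]\<close> rescaled by \<open>\<epsilon>\<close>.
\<close>
definition Sobolev_mass :: "real \<Rightarrow> real \<Rightarrow> 'a::euclidean_space set \<Rightarrow> ('a \<Rightarrow> real) \<Rightarrow> real \<Rightarrow> ('a \<Rightarrow> real) \<Rightarrow> real" where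
  "Sobolev_mass a p V m \<epsilon> u =
     (\<Sum>x\<in>V. m x * u x powr p) + short_range_energy V m (a * \<epsilon>) p u / (\<epsilon> ^ DIM('a) * \<epsilon> powr p)"

text \<open>
The condition \<open>\<epsilon> \<le> M * m x powr \<gamma>\<close> says that the weights are not too small compared to the
scale. For \<open>\<gamma> = 1/p - 1/q\<close> it is what \<open>inverse_inequality\<close> needs to pay for the passage from
\<open>L\<^sup>p\<close> to \<open>L\<^sup>q\<close> with one factor \<open>\<epsilon>\<close>.
\<close>
definition regular_graph :: "'a::euclidean_space set \<Rightarrow> real \<Rightarrow> real \<Rightarrow> real \<Rightarrow> real \<Rightarrow> real \<Rightarrow> 'a set \<Rightarrow> ('a \<Rightarrow> real) \<Rightarrow> real \<Rightarrow> bool" where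
  "regular_graph \<Omega> c\<^sub>1 c\<^sub>2 S M \<gamma> V m \<epsilon> \<longleftrightarrow>
     finite V \<and> V \<subseteq> \<Omega> \<and> 0 < \<epsilon> \<and> (\<forall>x\<in>V. 0 < m x \<and> \<epsilon> \<le> M * m x powr \<gamma>) \<and>
     ball_regular \<Omega> V m c\<^sub>1 c\<^sub>2 (S * \<epsilon>)"

lemma ball_regular_mono:
  "ball_regular \<Omega> V m c\<^sub>1 c\<^sub>2 s \<Longrightarrow> s \<le> s' \<Longrightarrow> ball_regular \<Omega> V m c\<^sub>1 c\<^sub>2 s'"
  unfolding ball_regular_def by (meson order_trans)

lemma regular_graph_mono:
  assumes "regular_graph \<Omega> c\<^sub>1 c\<^sub>2 S M \<gamma> V m \<epsilon>" "S \<le> S'"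
  shows "regular_graph \<Omega> c\<^sub>1 c\<^sub>2 S' M \<gamma> V m \<epsilon>"
proof -
  have "0 < \<epsilon>" using assms(1) by (simp add: regular_graph_def)
  then have "S * \<epsilon> \<le> S' * \<epsilon>" using assms(2) by (intro mult_right_mono) auto
  then show ?thesis using assms(1) unfolding regular_graph_def by (blast intro: ball_regular_mono)
qed

lemma short_range_energy_nonneg:
  assumes "\<And>x. x \<in> V \<Longrightarrow> 0 \<le> m x"
  shows "0 \<le> short_range_energy V m l p u"
  unfolding short_range_energy_def using assms by (auto intro!: sum_nonneg)

lemma powr_add_le:
  fixes a b p :: real
  assumes "0 \<le> a" "0 \<le> b" "0 \<le> p"
  shows "(a + b) powr p \<le> 2 powr p * (a powr p + b powr p)"
proof -
  have "(a + b) powr p \<le> (2 * max a b) powr p" using assms by (intro powr_mono2) auto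
  also have "\<dots> = 2 powr p * max a b powr p" using assms by (simp add: powr_mult)
  also have "max a b powr p \<le> a powr p + b powr p" by (simp add: max_def)
  finally show ?thesis by simp
qed

text \<open>
Each summand \<open>f x = m x * g x powr p\<close> is at most the whole sum, so \<open>f x powr (q / p)\<close> is at most
\<open>f x * Y powr (q / p - 1)\<close>; the exponent of the remaining weight, \<open>1 - q / p\<close>, is not positive, and
the lower bound for the weight takes care of it.
\<close>
lemma inverse_inequality:
  fixes m g :: "'b \<Rightarrow> real"
  assumes "finite B" "\<And>x. x \<in> B \<Longrightarrow> 0 < m x" "\<And>x. x \<in> B \<Longrightarrow> 0 \<le> g x"
    and p: "1 \<le> p" "p \<le> q" and "0 < \<epsilon>" "0 \<le> M" "\<And>x. x \<in> B \<Longrightarrow> \<epsilon> \<le> M * m x powr (1/p - 1/q)"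
    and Y: "(\<Sum>x\<in>B. m x * g x powr p) \<le> Y"
  shows "(\<Sum>x\<in>B. m x * g x powr q) \<le> (M / \<epsilon>) powr q * Y powr (q / p)"
proof -
  define f where "f x = m x * g x powr p" for x
  have f0: "0 \<le> f x" if "x \<in> B" for x using that assms by (simp add: f_def less_imp_le)
  have Y0: "0 \<le> Y" using Y f0 by (intro order_trans[OF sum_nonneg Y]) (auto simp: f_def)
  have "m x * g x powr q \<le> (M / \<epsilon>) powr q * (f x * Y powr (q / p - 1))" if x: "x \<in> B" for x
  proof (cases "g x = 0")
    case True then show ?thesis by (simp add: f_def)
  next
    case False
    have pos: "0 < m x" "0 < g x" "0 < f x" using False assms(2,3)[OF x] by (auto simp: f_def)
    have "f x \<le> Y" using member_le_sum[of x B f] assms f0 x Y by (force simp: f_def)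
    have "f x powr (q / p) = m x powr (q / p) * g x powr q"
      using pos p by (simp add: f_def powr_mult powr_powr)
    moreover have "m x = (m x powr (- (1/p - 1/q))) powr q * m x powr (q / p)"
      using pos p by (simp add: powr_powr algebra_simps flip: powr_add)
    ultimately have "m x * g x powr q = (m x powr (- (1/p - 1/q))) powr q * f x powr (q / p)"
      by (metis mult.assoc)
    also have "\<dots> \<le> (M / \<epsilon>) powr q * (f x * Y powr (q / p - 1))"
    proof (intro mult_mono powr_mono2)
      show "m x powr (- (1/p - 1/q)) \<le> M / \<epsilon>"
        using assms(8)[OF x] pos assms(6) by (simp add: powr_minus field_simps powr_diff)
      have "f x powr (q / p) = f x * f x powr (q / p - 1)"
        using pos by (simp add: powr_mult_base)
      also have "\<dots> \<le> f x * Y powr (q / p - 1)"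
        using pos \<open>f x \<le> Y\<close> p by (intro mult_left_mono powr_mono2) auto
      finally show "f x powr (q / p) \<le> f x * Y powr (q / p - 1)" .
    qed (use p in auto)
    finally show ?thesis .
  qed
  then have "(\<Sum>x\<in>B. m x * g x powr q) \<le> (\<Sum>x\<in>B. (M / \<epsilon>) powr q * (f x * Y powr (q / p - 1)))"
    by (rule sum_mono)
  also have "\<dots> = (M / \<epsilon>) powr q * (sum f B * Y powr (q / p - 1))"
    by (simp add: sum_distrib_left sum_distrib_right)
  also have "\<dots> \<le> (M / \<epsilon>) powr q * (Y * Y powr (q / p - 1))"
    using Y by (intro mult_left_mono mult_right_mono) (auto simp: f_def)
  also have "Y * Y powr (q / p - 1) = Y powr (q / p)"
    using Y0 p by (cases "Y = 0") (auto simp: powr_mult_base)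
  finally show ?thesis .
qed

text \<open>
Leibniz' rule for differences: the difference of \<open>\<phi> * u\<close> at two points of distance at most \<open>l\<close>
is at most that of \<open>u\<close> plus \<open>L * l * u\<close>.
\<close>
lemma cutoff_energy:
  fixes u :: "'a::euclidean_space \<Rightarrow> real"
  assumes V: "finite V" "\<And>x. x \<in> V \<Longrightarrow> 0 < m x" "\<And>x. x \<in> V \<Longrightarrow> 0 \<le> u x"
    and p: "0 \<le> p" and l: "0 \<le> l"
    and mass: "\<And>x. (\<Sum>y\<in>{y\<in>V. dist y x \<le> l}. m y) \<le> W"
    and \<phi>: "\<And>x. 0 \<le> \<phi> x" "\<And>x. \<phi> x \<le> 1" "\<And>x y. \<bar>\<phi> x - \<phi> y\<bar> \<le> L * dist x y" and "0 \<le> L"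
  shows "short_range_energy V m l p (\<lambda>x. \<phi> x * u x)
    \<le> 2 powr p * (short_range_energy V m l p u + (L * l) powr p * W * (\<Sum>x\<in>V. m x * u x powr p))"
proof -
  let ?N = "\<lambda>x. {y\<in>V. dist x y \<le> l}"
  have "short_range_energy V m l p (\<lambda>x. \<phi> x * u x)
     \<le> (\<Sum>x\<in>V. \<Sum>y\<in>?N x. m x * m y * (2 powr p * (\<bar>u x - u y\<bar> powr p + (L * l) powr p * u x powr p)))"
    unfolding short_range_energy_def
  proof (intro sum_mono mult_left_mono)
    fix x y assume x: "x \<in> V" and y: "y \<in> ?N x"
    have "\<phi> x * u x - \<phi> y * u y = \<phi> y * (u x - u y) + (\<phi> x - \<phi> y) * u x" by (simp add: algebra_simps)
    then have "\<bar>\<phi> x * u x - \<phi> y * u y\<bar> \<le> \<bar>\<phi> y * (u x - u y)\<bar> + \<bar>(\<phi> x - \<phi> y) * u x\<bar>" by simp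
    also have "\<dots> \<le> 1 * \<bar>u x - u y\<bar> + (L * l) * u x"
    proof (intro add_mono)
      show "\<bar>\<phi> y * (u x - u y)\<bar> \<le> 1 * \<bar>u x - u y\<bar>"
        unfolding abs_mult using \<phi>(1,2)[of y] by (intro mult_right_mono) auto
      have "\<bar>\<phi> x - \<phi> y\<bar> \<le> L * l"
        using \<phi>(3)[of x y] y \<open>0 \<le> L\<close> by (smt (verit) mem_Collect_eq mult_left_mono)
      then show "\<bar>(\<phi> x - \<phi> y) * u x\<bar> \<le> (L * l) * u x"
        unfolding abs_mult using V(3)[OF x] by (intro mult_mono) auto
    qed
    finally have "\<bar>\<phi> x * u x - \<phi> y * u y\<bar> powr p \<le> (\<bar>u x - u y\<bar> + (L * l) * u x) powr p"
      using p by (intro powr_mono2) auto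
    also have "\<dots> \<le> 2 powr p * (\<bar>u x - u y\<bar> powr p + ((L * l) * u x) powr p)"
      using p V(3)[OF x] \<open>0 \<le> L\<close> l by (intro powr_add_le) auto
    finally show "\<bar>\<phi> x * u x - \<phi> y * u y\<bar> powr p
       \<le> 2 powr p * (\<bar>u x - u y\<bar> powr p + (L * l) powr p * u x powr p)"
      using \<open>0 \<le> L\<close> l V(3)[OF x] by (simp add: powr_mult)
    show "0 \<le> m x * m y" using V(2)[OF x] V(2)[of y] y by (simp add: less_imp_le)
  qed
  also have "\<dots> = 2 powr p * (short_range_energy V m l p u
       + (L * l) powr p * (\<Sum>x\<in>V. m x * u x powr p * (\<Sum>y\<in>?N x. m y)))"
    by (simp add: short_range_energy_def sum_distrib_left sum.distrib algebra_simps)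
  also have "\<dots> \<le> 2 powr p * (short_range_energy V m l p u
       + (L * l) powr p * (\<Sum>x\<in>V. m x * u x powr p * W))"
    using mass V(2) by (intro mult_left_mono add_mono sum_mono) (auto simp: dist_commute less_imp_le)
  also have "\<dots> = 2 powr p * (short_range_energy V m l p u + (L * l) powr p * W * (\<Sum>x\<in>V. m x * u x powr p))"
    by (simp add: sum_distrib_left sum_distrib_right algebra_simps)
  finally show ?thesis .
qed

section \<open>The Sobolev inequality near a point of the closure\<close>

text \<open>
In a neighbourhood of \<open>z\<close> the cone of directions is fixed, and one slanted grid serves all scales.
The abstract comparison is applied to \<open>F = \<phi> * u\<close> with a cutoff \<open>\<phi>\<close> that is \<open>1\<close> on \<open>ball z r\<close>
and vanishes outside \<open>ball z (2 * r)\<close>; walks along the grid thus end before they leave the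
neighbourhood \<open>ball z (4 * r)\<close> of the cone property. On \<open>ball z r\<close> the function \<open>u = F\<close> is the sum
of the cell average \<open>w\<close>, controlled by the lattice Sobolev inequality, and of \<open>F - w\<close>, controlled
by the inverse inequality. The powers of \<open>\<epsilon>\<close> cancel in both.
\<close>
lemma local_graph_Sobolev:
  fixes \<Omega> :: "'a::euclidean_space set"
  assumes "open \<Omega>" "lipschitz_boundary \<Omega>" "z \<in> closure \<Omega>" and a: "0 < a"
  obtains r S where "0 < r" "0 < S"
    "\<And>p q c\<^sub>1 c\<^sub>2 M.
      \<lbrakk>1 \<le> p; p < real DIM('a); p \<le> q; q \<le> real DIM('a) * p / (real DIM('a) - p);
       0 < c\<^sub>1; 0 < c\<^sub>2; 0 \<le> M\<rbrakk> \<Longrightarrow>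
      \<exists>C\<ge>0. \<forall>V m \<epsilon> u. regular_graph \<Omega> c\<^sub>1 c\<^sub>2 S M (1/p - 1/q) V m \<epsilon> \<and> (\<forall>x\<in>V. 0 \<le> u x) \<and> a * \<epsilon> \<le> r
         \<longrightarrow> (\<Sum>x\<in>V \<inter> ball z r. m x * u x powr q) \<le> C * Sobolev_mass a p V m \<epsilon> u powr (q / p)"
proof -
  obtain e \<delta>\<^sub>0 R where e: "norm e = 1" and \<delta>\<^sub>0: "0 < \<delta>\<^sub>0" and R: "0 < R"
    and cone\<^sub>0: "\<And>x v s. \<lbrakk>x \<in> \<Omega>; x \<in> ball z R; norm (v - e) < \<delta>\<^sub>0; 0 \<le> s; x + s *\<^sub>R v \<in> ball z R\<rbrakk> \<Longrightarrow> x + s *\<^sub>R v \<in> \<Omega>"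
    using lipschitz_boundary_local_cone[OF assms(1-3)] by metis
  define \<delta> where "\<delta> = min \<delta>\<^sub>0 1"
  have \<delta>: "0 < \<delta>" "\<delta> \<le> 1" using \<delta>\<^sub>0 by (auto simp: \<delta>_def)
  have cone: "x + s *\<^sub>R v \<in> \<Omega>"
    if "x \<in> \<Omega>" "x \<in> ball z R" "norm (v - e) < \<delta>" "0 \<le> s" "x + s *\<^sub>R v \<in> ball z R" for x v s
    using that cone\<^sub>0[of x v s] by (simp add: \<delta>_def)
  obtain v :: "'a \<Rightarrow> 'a" and \<kappa> :: "real \<Rightarrow> 'a \<Rightarrow> 'a \<Rightarrow> int" and Cg \<rho> where
    Cg: "0 < Cg" and \<rho>: "0 < \<rho>" and v: "\<And>b. b \<in> Basis \<Longrightarrow> norm (v b - e) < \<delta>"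
    and ext: "\<And>h x. \<kappa> h x \<in> extensional Basis"
    and shift: "\<And>h x b. 0 < h \<Longrightarrow> b \<in> Basis \<Longrightarrow> \<kappa> h (x + h *\<^sub>R v b) = (\<kappa> h x)(b := \<kappa> h x b + 1)"
    and diam: "\<And>h x y. 0 < h \<Longrightarrow> \<kappa> h x = \<kappa> h y \<Longrightarrow> dist x y \<le> Cg * h"
    and inball: "\<And>h x. 0 < h \<Longrightarrow> \<exists>c. ball c (\<rho> * h) \<subseteq> {y. \<kappa> h y = \<kappa> h x}"
    by (rule slanted_grid[OF e \<delta>(1)]) (rule that)
  have nv: "norm (v b) \<le> 2" if "b \<in> Basis" for b
    using v[OF that] \<delta> e norm_triangle_sub[of "v b" e] by linarith
  \<comment> \<open>A point of \<open>\<Omega>\<close> is compared with the cell of the point \<open>M\<^sub>0 * h\<close> further in direction \<open>e\<close>.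
    That cell has diameter at most \<open>Cg * h\<close>, so for \<open>M\<^sub>0 > Cg / \<delta>\<close> it is seen from the point
    within the cone. With \<open>C\<^sub>2\<close>, all distances that occur are at most \<open>C\<^sub>2 * h\<close>, and the mesh
    \<open>h = a * \<epsilon> / C\<^sub>2\<close> keeps them within the range \<open>a * \<epsilon>\<close> of the energy.\<close>
  define M\<^sub>0 where "M\<^sub>0 = 2 * Cg / \<delta>"
  define C\<^sub>2 where "C\<^sub>2 = M\<^sub>0 + 2 * Cg + 2"
  have M\<^sub>0: "0 < M\<^sub>0" "Cg / M\<^sub>0 < \<delta>" using Cg \<delta> by (auto simp: M\<^sub>0_def)
  have C\<^sub>2: "0 < C\<^sub>2" using M\<^sub>0 Cg by (simp add: C\<^sub>2_def)
  define r where "r = R / 4"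
  \<comment> \<open>\<open>\<theta> * \<epsilon>\<close> is half the radius of a ball inscribed in every cell; the points must be regular
    at this scale for the cells to be charged.\<close>
  define \<theta> where "\<theta> = \<rho> * a / (2 * C\<^sub>2)"
  define S where "S = min a \<theta>"
  have r: "0 < r" using R by (simp add: r_def)
  have \<theta>: "0 < \<theta>" using \<rho> a C\<^sub>2 by (simp add: \<theta>_def)
  have S: "0 < S" using a \<theta> by (simp add: S_def)
  show ?thesis
  proof (rule that[OF r S])
    fix p q c\<^sub>1 c\<^sub>2 M :: real
    assume p: "1 \<le> p" "p < real DIM('a)" and q: "p \<le> q" "q \<le> real DIM('a) * p / (real DIM('a) - p)"
      and c: "0 < c\<^sub>1" "0 < c\<^sub>2" and M: "0 \<le> M"
    define d where "d = DIM('a)"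
    define ps where "ps = real d * p / (real d - p)"
    define A where "A = 2 powr p * (1 + (a / r) powr p * (c\<^sub>2 * a ^ d))"
    define b where "b = c\<^sub>1 * \<theta> ^ d"
    define b' where "b' = c\<^sub>2 * a ^ d"
    define s where "s = p * (real d - 1) / (real d - p)"
    define C where "C = 2 powr q * (b' * (1 / b + s powr ps * (A / b\<^sup>2) powr (ps / p)) + M powr q * (A / b) powr (q / p))"
    have d: "p < real d" using p by (simp add: d_def)
    have ps: "0 < ps" "(p - real d) * (ps / p) = - real d" using p d by (auto simp: ps_def field_simps)
    have bpos: "0 < b" "0 < b'" using c \<theta> a by (auto simp: b_def b'_def)
    have A: "0 < A" using c a r by (auto simp: A_def intro!: mult_pos_pos add_pos_nonneg)
    have s: "0 < s" using p d by (simp add: s_def)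
    show "\<exists>C\<ge>0. \<forall>V m \<epsilon> u. regular_graph \<Omega> c\<^sub>1 c\<^sub>2 S M (1/p - 1/q) V m \<epsilon> \<and> (\<forall>x\<in>V. 0 \<le> u x) \<and> a * \<epsilon> \<le> r
         \<longrightarrow> (\<Sum>x\<in>V \<inter> ball z r. m x * u x powr q) \<le> C * Sobolev_mass a p V m \<epsilon> u powr (q / p)"
    proof (intro exI[of _ C] conjI allI impI)
      show "0 \<le> C" using bpos by (simp add: C_def)
      fix V :: "'a set" and m u :: "'a \<Rightarrow> real" and \<epsilon> :: real
      assume asm: "regular_graph \<Omega> c\<^sub>1 c\<^sub>2 S M (1/p - 1/q) V m \<epsilon> \<and> (\<forall>x\<in>V. 0 \<le> u x) \<and> a * \<epsilon> \<le> r"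
      then have V: "finite V" "\<And>x. x \<in> V \<Longrightarrow> x \<in> \<Omega>" "\<And>x. x \<in> V \<Longrightarrow> 0 < m x" "\<And>x. x \<in> V \<Longrightarrow> 0 \<le> u x"
        and eM: "\<And>x. x \<in> V \<Longrightarrow> \<epsilon> \<le> M * m x powr (1/p - 1/q)"
        and \<epsilon>: "0 < \<epsilon>" "a * \<epsilon> \<le> r" and reg: "ball_regular \<Omega> V m c\<^sub>1 c\<^sub>2 (S * \<epsilon>)"
        by (auto simp: regular_graph_def)
      define X where "X = Sobolev_mass a p V m \<epsilon> u"
      define U where "U = (\<Sum>x\<in>V. m x * u x powr p)"
      define E where "E = short_range_energy V m (a * \<epsilon>) p u"
      define \<epsilon>d where "\<epsilon>d = \<epsilon> powr real d"
      have \<epsilon>d: "\<epsilon>d = \<epsilon> ^ d" "0 < \<epsilon>d" using \<epsilon> by (auto simp: \<epsilon>d_def powr_realpow)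
      have U0: "0 \<le> U" using V(3) by (auto simp: U_def less_imp_le intro!: sum_nonneg mult_nonneg_nonneg)
      have E0: "0 \<le> E"
        unfolding E_def using V(3) by (intro short_range_energy_nonneg) (simp add: less_imp_le)
      have UEX: "U + E / (\<epsilon>d * \<epsilon> powr p) = X"
        by (simp add: X_def Sobolev_mass_def U_def E_def \<epsilon>d d_def)
      have Edp: "0 \<le> E / (\<epsilon>d * \<epsilon> powr p)" using E0 \<epsilon>d \<epsilon> by simp
      have UX: "U \<le> X" and X0: "0 \<le> X" using UEX Edp U0 by linarith+
      have EX: "E \<le> \<epsilon>d * \<epsilon> powr p * X"
      proof -
        have "E / (\<epsilon>d * \<epsilon> powr p) \<le> X" using UEX U0 by linarith
        then show ?thesis using \<epsilon>d \<epsilon> by (simp add: field_simps)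
      qed
      define h where "h = a * \<epsilon> / C\<^sub>2"
      have h: "0 < h" "C\<^sub>2 * h = a * \<epsilon>" using a \<epsilon> C\<^sub>2 by (auto simp: h_def)
      have hC: "C\<^sub>2 * h = M\<^sub>0 * h + 2 * (Cg * h) + 2 * h" by (simp add: C\<^sub>2_def algebra_simps)
      have hpos: "0 < M\<^sub>0 * h" "0 < Cg * h" using h M\<^sub>0 Cg by auto
      have mass_le: "(\<Sum>y\<in>{y\<in>V. dist y x \<le> a * \<epsilon>}. m y) \<le> b' * \<epsilon>d" for x
      proof -
        have "S * \<epsilon> \<le> a * \<epsilon>" using \<epsilon> by (simp add: S_def)
        then have "(\<Sum>y\<in>{y\<in>V. dist y x \<le> a * \<epsilon>}. m y) \<le> c\<^sub>2 * (a * \<epsilon>) ^ d"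
          using reg unfolding ball_regular_def d_def by blast
        then show ?thesis by (simp add: b'_def \<epsilon>d power_mult_distrib algebra_simps)
      qed
      have move: "\<exists>x'. \<kappa> h x' = \<kappa> h x \<and> y = x' + h *\<^sub>R v i \<and> dist x' x \<le> Cg * h \<and> dist x y \<le> C\<^sub>2 * h"
        if "i \<in> Basis" "\<kappa> h y = (\<kappa> h x)(i := \<kappa> h x i + 1)" for i x y
      proof (intro exI conjI)
        let ?x = "y - h *\<^sub>R v i"
        have "(\<kappa> h ?x)(i := \<kappa> h ?x i + 1) = (\<kappa> h x)(i := \<kappa> h x i + 1)"
          using shift[OF h(1) that(1), of ?x] that(2) by simp
        then show eq: "\<kappa> h ?x = \<kappa> h x"
          by (metis add_right_cancel fun_upd_same fun_upd_triv fun_upd_upd)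
        show "y = ?x + h *\<^sub>R v i" by simp
        show *: "dist ?x x \<le> Cg * h" by (rule diam[OF h(1) eq])
        have "dist x y \<le> dist ?x x + dist ?x y" by (rule dist_triangle3)
        moreover have "dist ?x y = h * norm (v i)" using h by (simp add: dist_norm)
        moreover have "h * norm (v i) \<le> h * 2" using nv[OF that(1)] h by (intro mult_left_mono) auto
        ultimately show "dist x y \<le> C\<^sub>2 * h" using * hC hpos by linarith
      qed
      \<comment> \<open>The witness \<open>x\<close> excludes functions that are not the index of any cell.\<close>
      define G where "G = {k. \<exists>x. \<kappa> h x = k \<and> {y. \<kappa> h y = k} \<subseteq> \<Omega>}"
      define \<phi> where "\<phi> x = max 0 (min 1 (2 - dist x z / r))" for x
      define F where "F x = \<phi> x * u x" for x
      define P where "P = A * \<epsilon>d * \<epsilon> powr p * X"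
      define \<kappa>' where "\<kappa>' x = \<kappa> h (x + (M\<^sub>0 * h) *\<^sub>R e)" for x
      let ?B = "V \<inter> ball z r"
      have \<phi>1: "\<phi> x = 1" if "x \<in> ball z r" for x
        using that r by (simp add: \<phi>_def dist_commute field_simps)
      have \<phi>2: "x \<in> ball z (2 * r)" if "\<phi> x \<noteq> 0" for x
        using that r by (auto simp: \<phi>_def dist_commute field_simps max_def min_def split: if_splits)
      have \<phi>L: "\<bar>\<phi> x - \<phi> y\<bar> \<le> (1 / r) * dist x y" for x y
      proof -
        have "\<bar>\<phi> x - \<phi> y\<bar> \<le> \<bar>dist x z / r - dist y z / r\<bar>" by (auto simp: \<phi>_def max_def min_def)
        also have "\<dots> = \<bar>dist x z - dist y z\<bar> / r" using r by (simp add: diff_divide_distrib[symmetric])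
        also have "\<dots> \<le> dist x y / r"
          using r dist_triangle[of x z y] dist_triangle[of y z x] by (intro divide_right_mono) (auto simp: dist_commute)
        finally show ?thesis by simp
      qed
      have FP: "short_range_energy V m (a * \<epsilon>) p F \<le> P"
      proof -
        have "short_range_energy V m (a * \<epsilon>) p F \<le> 2 powr p * (E + ((1 / r) * (a * \<epsilon>)) powr p * (b' * \<epsilon>d) * U)"
          unfolding F_def E_def U_def
          by (rule cutoff_energy) (use V p a \<epsilon> r mass_le \<phi>L in \<open>auto simp: \<phi>_def\<close>)
        also have "((1 / r) * (a * \<epsilon>)) powr p = (a / r) powr p * \<epsilon> powr p"
          by (simp flip: powr_mult)
        also have "2 powr p * (E + (a / r) powr p * \<epsilon> powr p * (b' * \<epsilon>d) * U)
          \<le> 2 powr p * (\<epsilon>d * \<epsilon> powr p * X + (a / r) powr p * \<epsilon> powr p * (b' * \<epsilon>d) * X)"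
          using EX UX bpos \<epsilon>d by (intro mult_left_mono add_mono) auto
        also have "\<dots> = P" by (simp add: P_def A_def b'_def algebra_simps)
        finally show ?thesis .
      qed
      obtain w where w: "\<And>x. 0 \<le> w x" "(\<Sum>x\<in>?B. m x * \<bar>F x - w x\<bar> powr p) \<le> P / (b * \<epsilon>d)"
        and wq: "\<And>q n. \<lbrakk>p \<le> q; q \<le> ps; 0 < n\<rbrakk> \<Longrightarrow>
         (\<Sum>x\<in>?B. m x * w x powr q) \<le> b' * \<epsilon>d * (n powr (q - p) * ((\<Sum>x\<in>V. m x * F x powr p) / (b * \<epsilon>d))
          + n powr (q - ps) * (s * (P / (b * \<epsilon>d)\<^sup>2) powr (1/p)) powr ps)"
      proof (rule cell_average_Sobolev[where I = "Basis :: 'a set" and V = V and m = m and F = F and \<kappa> = "\<kappa> h"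
            and \<kappa>' = \<kappa>' and G = G and near = "\<lambda>x y. dist x y \<le> a * \<epsilon>" and p = p and M = "b * \<epsilon>d"
            and M' = "b' * \<epsilon>d" and P = P and B = ?B])
        show "0 \<le> F x" if "x \<in> V" for x using V(4)[OF that] by (simp add: F_def \<phi>_def)
        show "0 < b * \<epsilon>d" using bpos \<epsilon>d by simp
        show "b * \<epsilon>d \<le> (\<Sum>x\<in>{x\<in>V. \<kappa> h x = k}. m x)" if k: "k \<in> G" for k
        proof -
          obtain x where x: "\<kappa> h x = k" "{y. \<kappa> h y = k} \<subseteq> \<Omega>" using k unfolding G_def by blast
          obtain c where cc: "ball c (\<rho> * h) \<subseteq> {y. \<kappa> h y = k}" using inball[OF h(1), of x] x by auto
          have th: "\<rho> * h / 2 = \<theta> * \<epsilon>" by (simp add: \<theta>_def h_def)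
          have "ball c (\<theta> * \<epsilon>) \<subseteq> ball c (\<rho> * h)" using \<rho> h unfolding th[symmetric] by (intro subset_ball) auto
          then have "ball c (\<theta> * \<epsilon>) \<subseteq> \<Omega>" using cc x by blast
          moreover have "S * \<epsilon> \<le> \<theta> * \<epsilon>" using \<epsilon> by (simp add: S_def)
          ultimately have "c\<^sub>1 * (\<theta> * \<epsilon>) ^ d \<le> (\<Sum>y\<in>{y\<in>V. dist y c < 2 * (\<theta> * \<epsilon>)}. m y)"
            using reg unfolding ball_regular_def d_def by blast
          also have "\<dots> \<le> (\<Sum>x\<in>{x\<in>V. \<kappa> h x = k}. m x)"
          proof (rule sum_mono2)
            show "{y \<in> V. dist y c < 2 * (\<theta> * \<epsilon>)} \<subseteq> {x \<in> V. \<kappa> h x = k}"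
              using cc th by (auto simp: dist_commute subset_iff)
          qed (use V in \<open>auto simp: less_imp_le\<close>)
          finally show ?thesis by (simp add: b_def \<epsilon>d power_mult_distrib algebra_simps)
        qed
        show "(\<kappa> h x)(i := \<kappa> h x i + 1) \<in> G"
          if "i \<in> Basis" "x \<in> V" "\<kappa> h x \<in> G" "F x \<noteq> 0" for i x
        proof -
          have xz: "x \<in> ball z (2 * r)" using that(4) \<phi>2 by (auto simp: F_def)
          have sub: "{y. \<kappa> h y = \<kappa> h x} \<subseteq> \<Omega>" using that(3) by (auto simp: G_def)
          have "y \<in> \<Omega>" if y: "\<kappa> h y = (\<kappa> h x)(i := \<kappa> h x i + 1)" for y
          proof -
            obtain x' where x': "\<kappa> h x' = \<kappa> h x" "y = x' + h *\<^sub>R v i" "dist x' x \<le> Cg * h" "dist x y \<le> C\<^sub>2 * h"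
              using move[OF \<open>i \<in> Basis\<close> y] by blast
            have "x' \<in> ball z R" "y \<in> ball z R"
              using xz x'(3,4) dist_triangle[of z x' x] dist_triangle[of z y x] h \<epsilon>(2) hC hpos R
              unfolding mem_ball r_def by (auto simp: dist_commute)
            then show ?thesis
              using cone[of x' "v i" h] x' sub v[OF \<open>i \<in> Basis\<close>] h by auto
          qed
          then show ?thesis unfolding G_def
            using shift[OF h(1) \<open>i \<in> Basis\<close>, of x] by blast
        qed
        show "dist x y \<le> a * \<epsilon>" if "i \<in> Basis" "\<kappa> h y = (\<kappa> h x)(i := \<kappa> h x i + 1)" for i x y
          using move[OF that] h by auto
        show "(\<Sum>x\<in>V. \<Sum>y\<in>{y \<in> V. dist x y \<le> a * \<epsilon>}. m x * m y * \<bar>F x - F y\<bar> powr p) \<le> P"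
          using FP by (simp add: short_range_energy_def)
        have near': "dist x y \<le> (M\<^sub>0 + Cg) * h" "norm (y - (x + (M\<^sub>0 * h) *\<^sub>R e)) \<le> Cg * h" if "\<kappa> h y = \<kappa>' x" for x y
        proof -
          have "dist y (x + (M\<^sub>0 * h) *\<^sub>R e) \<le> Cg * h" using diam[OF h(1) that[unfolded \<kappa>'_def]] .
          then show "norm (y - (x + (M\<^sub>0 * h) *\<^sub>R e)) \<le> Cg * h" by (simp add: dist_norm)
          moreover have "norm ((M\<^sub>0 * h) *\<^sub>R e) = M\<^sub>0 * h" using hpos e by simp
          moreover have "y - x = (y - (x + (M\<^sub>0 * h) *\<^sub>R e)) + (M\<^sub>0 * h) *\<^sub>R e" by simp
          ultimately have "norm (y - x) \<le> Cg * h + M\<^sub>0 * h"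
            by (metis norm_triangle_mono order_refl)
          then show "dist x y \<le> (M\<^sub>0 + Cg) * h" by (simp add: dist_norm norm_minus_commute algebra_simps)
        qed
        have le: "(M\<^sub>0 + Cg) * h \<le> a * \<epsilon>" using h hC hpos by (simp add: algebra_simps)
        show "\<kappa>' x \<in> G" if "x \<in> ?B" for x
        proof -
          have "y \<in> \<Omega>" if y: "\<kappa> h y = \<kappa>' x" for y
          proof -
            define \<zeta> where "\<zeta> = (1 / (M\<^sub>0 * h)) *\<^sub>R (y - (x + (M\<^sub>0 * h) *\<^sub>R e))"
            have "norm \<zeta> = norm (y - (x + (M\<^sub>0 * h) *\<^sub>R e)) / (M\<^sub>0 * h)" using hpos by (simp add: \<zeta>_def)
            also have "\<dots> \<le> Cg * h / (M\<^sub>0 * h)" using near'(2)[OF y] hpos by (intro divide_right_mono) auto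
            also have "\<dots> < \<delta>" using M\<^sub>0 h by simp
            finally have n: "norm ((e + \<zeta>) - e) < \<delta>" by simp
            have yx: "y = x + (M\<^sub>0 * h) *\<^sub>R (e + \<zeta>)"
              using M\<^sub>0(1) h(1) by (simp add: \<zeta>_def scaleR_add_right)
            have "x \<in> ball z R" "y \<in> ball z R"
              using \<open>x \<in> ?B\<close> near'(1)[OF y] le \<epsilon>(2) dist_triangle[of z y x] R by (auto simp: r_def)
            then show ?thesis
              using cone[of x "e + \<zeta>" "M\<^sub>0 * h"] V(2)[of x] \<open>x \<in> ?B\<close> n yx hpos by auto
          qed
          then show ?thesis unfolding G_def \<kappa>'_def by blast
        qed
        show "dist x y \<le> a * \<epsilon>" if "\<kappa> h y = \<kappa>' x" for x y using near'(1)[OF that] le by linarith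
        show "(\<Sum>x\<in>{x \<in> ?B. \<kappa>' x = k}. m x) \<le> b' * \<epsilon>d" for k
        proof (cases "{x \<in> ?B. \<kappa>' x = k} = {}")
          case True
          show ?thesis unfolding True using bpos \<epsilon>d by simp
        next
          case False
          then obtain x where x: "x \<in> ?B" "\<kappa>' x = k" by blast
          have "dist y x \<le> a * \<epsilon>" if "\<kappa>' y = k" for y
          proof -
            have "dist (y + (M\<^sub>0 * h) *\<^sub>R e) (x + (M\<^sub>0 * h) *\<^sub>R e) \<le> Cg * h"
              using x that by (intro diam[OF h(1)]) (simp add: \<kappa>'_def)
            then show ?thesis using h hC hpos by simp
          qed
          then have "(\<Sum>x\<in>{x \<in> ?B. \<kappa>' x = k}. m x) \<le> (\<Sum>y\<in>{y\<in>V. dist y x \<le> a * \<epsilon>}. m y)"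
            using V by (intro sum_mono2) (auto simp: less_imp_le)
          also have "\<dots> \<le> b' * \<epsilon>d" by (rule mass_le)
          finally show ?thesis .
        qed
      qed (use p V ext that in \<open>auto simp: ps_def s_def d_def\<close>)
      have UF: "(\<Sum>x\<in>V. m x * F x powr p) \<le> U"
        unfolding U_def
      proof (intro sum_mono mult_left_mono powr_mono2)
        fix x assume "x \<in> V"
        then show "F x \<le> u x" "0 \<le> F x" using V(4) by (auto simp: F_def \<phi>_def mult_left_le_one_le)
      qed (use p V in \<open>auto simp: less_imp_le\<close>)
      have "(\<Sum>x\<in>?B. m x * u x powr q) \<le> C * X powr (q / p)"
      proof (cases "X = 0")
        case True
        then have "U = 0" using UX U0 by simp
        then have "\<forall>x\<in>V. m x * u x powr p = 0"
          unfolding U_def using V by (subst (asm) sum_nonneg_eq_0_iff) (auto simp: less_imp_le)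
        then have "\<forall>x\<in>?B. m x * u x powr q = 0" using V(3) by fastforce
        then have "(\<Sum>x\<in>?B. m x * u x powr q) = 0" by (rule sum.neutral)
        then show ?thesis using \<open>X = 0\<close> by simp
      next
        case False
        then have Xp: "0 < X" using X0 by simp
        have bulk: "(\<Sum>x\<in>?B. m x * w x powr q) \<le> b' * (1 / b + s powr ps * (A / b\<^sup>2) powr (ps / p)) * X powr (q / p)"
        proof -
          \<comment> \<open>Interpolation at the height \<open>X powr (1/p)\<close> makes both terms multiples of \<open>X powr (q/p)\<close>.\<close>
          have n: "0 < X powr (1/p)" using Xp by simp
          have "(\<Sum>x\<in>?B. m x * w x powr q) \<le> b' * \<epsilon>d * ((X powr (1/p)) powr (q - p) * ((\<Sum>x\<in>V. m x * F x powr p) / (b * \<epsilon>d))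
            + (X powr (1/p)) powr (q - ps) * (s * (P / (b * \<epsilon>d)\<^sup>2) powr (1/p)) powr ps)"
            by (rule wq[OF q(1) _ n]) (use q(2) in \<open>simp add: ps_def d_def\<close>)
          also have "\<dots> \<le> b' * \<epsilon>d * ((X powr (1/p)) powr (q - p) * (X / (b * \<epsilon>d))
            + (X powr (1/p)) powr (q - ps) * (s * (P / (b * \<epsilon>d)\<^sup>2) powr (1/p)) powr ps)"
            using UF UX bpos \<epsilon>d by (intro mult_left_mono add_right_mono divide_right_mono) auto
          also have "(s * (P / (b * \<epsilon>d)\<^sup>2) powr (1/p)) powr ps
              = s powr ps * (A / b\<^sup>2) powr (ps / p) * X powr (ps / p) / \<epsilon>d"
          proof -
            have "P / (b * \<epsilon>d)\<^sup>2 = (A / b\<^sup>2) * (\<epsilon> powr (p - real d) * X)"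
              using \<epsilon> \<epsilon>d by (simp add: P_def power2_eq_square powr_diff field_simps \<epsilon>d_def)
            moreover have "(\<epsilon> powr (p - real d)) powr (ps / p) = 1 / \<epsilon>d"
              using \<epsilon> by (simp only: powr_powr ps(2)) (simp add: \<epsilon>d_def powr_minus_divide)
            moreover have "(s * Y powr (1/p)) powr ps = s powr ps * Y powr (ps / p)" for Y
              by (simp add: powr_mult powr_powr)
            moreover have "(A / b\<^sup>2 * (\<epsilon> powr (p - real d) * X)) powr (ps / p)
              = (A / b\<^sup>2) powr (ps / p) * ((\<epsilon> powr (p - real d)) powr (ps / p) * X powr (ps / p))"
              by (simp only: powr_mult)
            ultimately show ?thesis by simp
          qed
          also have "b' * \<epsilon>d * ((X powr (1/p)) powr (q - p) * (X / (b * \<epsilon>d))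
            + (X powr (1/p)) powr (q - ps) * (s powr ps * (A / b\<^sup>2) powr (ps / p) * X powr (ps / p) / \<epsilon>d))
            = b' * ((X powr ((q - p) / p) * X) / b
              + (X powr ((q - ps) / p) * X powr (ps / p)) * (s powr ps * (A / b\<^sup>2) powr (ps / p)))"
            using \<epsilon>d(2) by (simp add: powr_powr field_simps)
          also have "X powr ((q - p) / p) * X = X powr (q / p)"
          proof -
            have "X powr ((q - p) / p) * X powr 1 = X powr (q / p)"
              using p by (subst powr_add[symmetric]) (simp add: diff_divide_distrib)
            then show ?thesis using Xp by simp
          qed
          also have "X powr ((q - ps) / p) * X powr (ps / p) = X powr (q / p)"
            by (subst powr_add[symmetric]) (simp add: diff_divide_distrib)
          finally show ?thesis by (simp add: algebra_simps)
        qed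
        have osc: "(\<Sum>x\<in>?B. m x * \<bar>F x - w x\<bar> powr q) \<le> M powr q * (A / b) powr (q / p) * X powr (q / p)"
        proof -
          have "(\<Sum>x\<in>?B. m x * \<bar>F x - w x\<bar> powr q) \<le> (M / \<epsilon>) powr q * (A / b * \<epsilon> powr p * X) powr (q / p)"
          proof (rule inverse_inequality)
            show "(\<Sum>x\<in>?B. m x * \<bar>F x - w x\<bar> powr p) \<le> A / b * \<epsilon> powr p * X"
              using w(2) \<epsilon>d(2) by (simp add: P_def)
          qed (use V p q \<epsilon> M eM in auto)
          also have "\<dots> = M powr q * (A / b) powr (q / p) * X powr (q / p)"
            using \<epsilon> p by (simp add: powr_mult powr_powr powr_divide)
          finally show ?thesis .
        qed
        have "(\<Sum>x\<in>?B. m x * u x powr q) \<le> (\<Sum>x\<in>?B. m x * (2 powr q * (w x powr q + \<bar>F x - w x\<bar> powr q)))"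
        proof (intro sum_mono mult_left_mono)
          fix x assume x: "x \<in> ?B"
          have "u x powr q \<le> (w x + \<bar>F x - w x\<bar>) powr q"
            using x \<phi>1[of x] V(4)[of x] p q by (intro powr_mono2) (auto simp: F_def)
          also have "\<dots> \<le> 2 powr q * (w x powr q + \<bar>F x - w x\<bar> powr q)"
            using w(1) p q by (intro powr_add_le) auto
          finally show "u x powr q \<le> 2 powr q * (w x powr q + \<bar>F x - w x\<bar> powr q)" .
        qed (use V in \<open>auto simp: less_imp_le\<close>)
        also have "\<dots> = 2 powr q * ((\<Sum>x\<in>?B. m x * w x powr q) + (\<Sum>x\<in>?B. m x * \<bar>F x - w x\<bar> powr q))"
          by (simp add: sum_distrib_left sum.distrib algebra_simps)
        also have "\<dots> \<le> 2 powr q * (b' * (1 / b + s powr ps * (A / b\<^sup>2) powr (ps / p)) * X powr (q / p)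
            + M powr q * (A / b) powr (q / p) * X powr (q / p))"
          by (intro mult_left_mono add_mono bulk osc) auto
        also have "\<dots> = C * X powr (q / p)" by (simp add: C_def algebra_simps)
        finally show ?thesis .
      qed
      then show "(\<Sum>x\<in>?B. m x * u x powr q) \<le> C * Sobolev_mass a p V m \<epsilon> u powr (q / p)"
        unfolding X_def .
    qed
  qed
qed

section \<open>The Sobolev inequality on the whole graph\<close>

lemma sum_le_sum_over_cover:
  fixes f :: "'a \<Rightarrow> real"
  assumes "finite V" "finite Z" "V \<subseteq> (\<Union>z\<in>Z. A z)" "\<And>x. x \<in> V \<Longrightarrow> 0 \<le> f x"
  shows "sum f V \<le> (\<Sum>z\<in>Z. sum f (V \<inter> A z))"
proof -
  have "sum f V \<le> (\<Sum>x\<in>V. \<Sum>z\<in>Z. if x \<in> A z then f x else 0)"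
  proof (rule sum_mono)
    fix x assume x: "x \<in> V"
    then obtain z where "z \<in> Z" "x \<in> A z" using assms(3) by blast
    then show "f x \<le> (\<Sum>z\<in>Z. if x \<in> A z then f x else 0)"
      using member_le_sum[of z Z "\<lambda>z. if x \<in> A z then f x else 0"] assms(2,4) x by auto
  qed
  also have "\<dots> = (\<Sum>z\<in>Z. sum f (V \<inter> A z))"
    using assms(1) by (subst sum.swap) (simp add: sum.inter_restrict)
  finally show ?thesis .
qed

text \<open>
Finitely many of the neighbourhoods of the local result cover the compact closure of \<open>\<Omega>\<close>. They
settle the scales below some \<open>r\<^sub>0 / a\<close>. For larger \<open>\<epsilon>\<close> all weights are bounded away from \<open>0\<close>, and
the inverse inequality alone suffices. The admissible scale \<open>S\<close> of regularity depends on \<open>\<Omega>\<close> and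
\<open>a\<close> only, before the exponents and the weights are chosen.
\<close>
lemma graph_Sobolev_short_range:
  fixes \<Omega> :: "'a::euclidean_space set"
  assumes "open \<Omega>" "bounded \<Omega>" "lipschitz_boundary \<Omega>" and a: "0 < a"
  obtains S where "0 < S"
    "\<And>p q c\<^sub>1 c\<^sub>2 M.
      \<lbrakk>1 \<le> p; p < real DIM('a); p \<le> q; q \<le> real DIM('a) * p / (real DIM('a) - p);
       0 < c\<^sub>1; 0 < c\<^sub>2; 0 \<le> M\<rbrakk> \<Longrightarrow>
      \<exists>C\<ge>0. \<forall>V m \<epsilon> u. regular_graph \<Omega> c\<^sub>1 c\<^sub>2 S M (1/p - 1/q) V m \<epsilon> \<and> (\<forall>x\<in>V. 0 \<le> u x)
         \<longrightarrow> (\<Sum>x\<in>V. m x * u x powr q) \<le> C * Sobolev_mass a p V m \<epsilon> u powr (q / p)"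
proof -
  define bound where "bound p q c\<^sub>1 c\<^sub>2 M z r S C \<longleftrightarrow>
    (\<forall>V m \<epsilon> u. regular_graph \<Omega> c\<^sub>1 c\<^sub>2 S M (1/p - 1/q) V m \<epsilon> \<and> (\<forall>x\<in>V. 0 \<le> u x) \<and> a * \<epsilon> \<le> r
         \<longrightarrow> (\<Sum>x\<in>V \<inter> ball z r. m x * u x powr q) \<le> C * Sobolev_mass a p V m \<epsilon> u powr (q / p))"
    for p q c\<^sub>1 c\<^sub>2 M z r S C
  define admissible where "admissible p q c\<^sub>1 c\<^sub>2 M \<longleftrightarrow> 1 \<le> p \<and> p < real DIM('a) \<and> p \<le> q \<and>
      q \<le> real DIM('a) * p / (real DIM('a) - p) \<and> 0 < c\<^sub>1 \<and> 0 < c\<^sub>2 \<and> 0 \<le> M" for p q c\<^sub>1 c\<^sub>2 M :: real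
  have "\<exists>r S. 0 < r \<and> 0 < S \<and> (\<forall>p q c\<^sub>1 c\<^sub>2 M. admissible p q c\<^sub>1 c\<^sub>2 M \<longrightarrow> (\<exists>C\<ge>0. bound p q c\<^sub>1 c\<^sub>2 M z r S C))"
    if z: "z \<in> closure \<Omega>" for z
  proof (rule local_graph_Sobolev[OF assms(1,3) z a])
    fix r S :: real
    assume rS: "0 < r" "0 < S" and H: "\<And>p q c\<^sub>1 c\<^sub>2 M. \<lbrakk>1 \<le> p; p < real DIM('a); p \<le> q; q \<le> real DIM('a) * p / (real DIM('a) - p); 0 < c\<^sub>1; 0 < c\<^sub>2; 0 \<le> M\<rbrakk> \<Longrightarrow>
      \<exists>C\<ge>0. \<forall>V m \<epsilon> u. regular_graph \<Omega> c\<^sub>1 c\<^sub>2 S M (1/p - 1/q) V m \<epsilon> \<and> (\<forall>x\<in>V. 0 \<le> u x) \<and> a * \<epsilon> \<le> r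
         \<longrightarrow> (\<Sum>x\<in>V \<inter> ball z r. m x * u x powr q) \<le> C * Sobolev_mass a p V m \<epsilon> u powr (q / p)"
    have "\<exists>C\<ge>0. bound p q c\<^sub>1 c\<^sub>2 M z r S C" if "admissible p q c\<^sub>1 c\<^sub>2 M" for p q c\<^sub>1 c\<^sub>2 M
      unfolding bound_def by (rule H) (use that in \<open>auto simp: admissible_def\<close>)
    with rS show ?thesis by blast
  qed
  then obtain r S where r: "\<And>z. z \<in> closure \<Omega> \<Longrightarrow> 0 < r z" and S: "\<And>z. z \<in> closure \<Omega> \<Longrightarrow> 0 < S z"
    and loc: "\<And>z p q c\<^sub>1 c\<^sub>2 M. z \<in> closure \<Omega> \<Longrightarrow> admissible p q c\<^sub>1 c\<^sub>2 M
      \<Longrightarrow> \<exists>C\<ge>0. bound p q c\<^sub>1 c\<^sub>2 M z (r z) (S z) C"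
    by metis
  have "compact (closure \<Omega>)" using assms(2) by (simp add: compact_closure)
  moreover have "closure \<Omega> \<subseteq> (\<Union>z\<in>closure \<Omega>. ball z (r z))" using r by auto
  ultimately obtain Z where Z: "Z \<subseteq> closure \<Omega>" "finite Z" "closure \<Omega> \<subseteq> (\<Union>z\<in>Z. ball z (r z))"
    using compactE_image[of "closure \<Omega>" "closure \<Omega>" "\<lambda>z. ball z (r z)"] open_ball by metis
  define r\<^sub>0 where "r\<^sub>0 = Min (insert 1 (r ` Z))"
  define S\<^sub>0 where "S\<^sub>0 = Min (insert 1 (S ` Z))"
  have r\<^sub>0: "0 < r\<^sub>0" "\<And>z. z \<in> Z \<Longrightarrow> r\<^sub>0 \<le> r z" using Z r by (auto simp: r\<^sub>0_def)
  have S\<^sub>0: "0 < S\<^sub>0" "\<And>z. z \<in> Z \<Longrightarrow> S\<^sub>0 \<le> S z" using Z S by (auto simp: S\<^sub>0_def)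
  show ?thesis
  proof (rule that[OF S\<^sub>0(1)])
    fix p q c\<^sub>1 c\<^sub>2 M :: real
    assume p: "1 \<le> p" "p < real DIM('a)" "p \<le> q" "q \<le> real DIM('a) * p / (real DIM('a) - p)" "0 < c\<^sub>1" "0 < c\<^sub>2" "0 \<le> M"
    have "\<forall>z\<in>Z. \<exists>C\<ge>0. bound p q c\<^sub>1 c\<^sub>2 M z (r z) (S z) C"
      using loc[of _ p q c\<^sub>1 c\<^sub>2 M] p Z(1) by (auto simp: admissible_def)
    then obtain c where c0: "\<And>z. z \<in> Z \<Longrightarrow> 0 \<le> c z" and c: "\<And>z. z \<in> Z \<Longrightarrow> bound p q c\<^sub>1 c\<^sub>2 M z (r z) (S z) (c z)"
      by metis
    define C where "C = sum c Z + (M * a / r\<^sub>0) powr q"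
    have C: "sum c Z \<le> C" "(M * a / r\<^sub>0) powr q \<le> C" "0 \<le> C"
      using c0 by (auto simp: C_def intro!: sum_nonneg add_nonneg_nonneg)
    show "\<exists>C\<ge>0. \<forall>V m \<epsilon> u. regular_graph \<Omega> c\<^sub>1 c\<^sub>2 S\<^sub>0 M (1/p - 1/q) V m \<epsilon> \<and> (\<forall>x\<in>V. 0 \<le> u x)
         \<longrightarrow> (\<Sum>x\<in>V. m x * u x powr q) \<le> C * Sobolev_mass a p V m \<epsilon> u powr (q / p)"
    proof (intro exI[of _ C] conjI allI impI C(3))
      fix V :: "'a set" and m u :: "'a \<Rightarrow> real" and \<epsilon> :: real
      assume asm: "regular_graph \<Omega> c\<^sub>1 c\<^sub>2 S\<^sub>0 M (1/p - 1/q) V m \<epsilon> \<and> (\<forall>x\<in>V. 0 \<le> u x)"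
      then have V: "finite V" "V \<subseteq> \<Omega>" "\<And>x. x \<in> V \<Longrightarrow> 0 < m x" "\<And>x. x \<in> V \<Longrightarrow> 0 \<le> u x"
        and \<epsilon>: "0 < \<epsilon>" "\<And>x. x \<in> V \<Longrightarrow> \<epsilon> \<le> M * m x powr (1/p - 1/q)"
        by (auto simp: regular_graph_def)
      define X where "X = Sobolev_mass a p V m \<epsilon> u"
      have "(\<Sum>x\<in>V. m x * u x powr q) \<le> C * X powr (q / p)"
      proof (cases "a * \<epsilon> \<le> r\<^sub>0")
        case True
        have nn: "0 \<le> m x * u x powr q" if "x \<in> V" for x using V(3)[OF that] by simp
        have bound: "(\<Sum>x\<in>V \<inter> ball z (r z). m x * u x powr q) \<le> c z * X powr (q / p)" if z: "z \<in> Z" for z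
        proof -
          have "a * \<epsilon> \<le> r z" using True r\<^sub>0(2)[OF z] by simp
          moreover have "regular_graph \<Omega> c\<^sub>1 c\<^sub>2 (S z) M (1/p - 1/q) V m \<epsilon>"
            using asm S\<^sub>0(2)[OF z] by (blast intro: regular_graph_mono)
          ultimately show ?thesis
            unfolding X_def using asm
            by (intro c[OF z, unfolded bound_def, THEN spec[of _ V], THEN spec[of _ m],
                  THEN spec[of _ \<epsilon>], THEN spec[of _ u], THEN mp] conjI) simp_all
        qed
        have "V \<subseteq> (\<Union>z\<in>Z. ball z (r z))"
          using V(2) closure_subset Z(3) by (rule order_trans[OF order_trans])
        then have "(\<Sum>x\<in>V. m x * u x powr q) \<le> (\<Sum>z\<in>Z. \<Sum>x\<in>V \<inter> ball z (r z). m x * u x powr q)"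
          using V(1) Z(2) nn by (intro sum_le_sum_over_cover)
        also have "\<dots> \<le> (\<Sum>z\<in>Z. c z * X powr (q / p))" by (intro sum_mono bound)
        also have "\<dots> \<le> C * X powr (q / p)"
          using C by (simp add: mult_right_mono flip: sum_distrib_right)
        finally show ?thesis .
      next
        case False
        have "0 \<le> short_range_energy V m (a * \<epsilon>) p u"
          using V(3) by (intro short_range_energy_nonneg) (simp add: less_imp_le)
        then have U: "(\<Sum>x\<in>V. m x * u x powr p) \<le> X"
          using \<epsilon>(1) by (simp add: X_def Sobolev_mass_def)
        have "(\<Sum>x\<in>V. m x * u x powr q) \<le> (M / \<epsilon>) powr q * X powr (q / p)"
          by (rule inverse_inequality) (use V \<epsilon> p U in auto)
        also have "\<dots> \<le> (M * a / r\<^sub>0) powr q * X powr (q / p)"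
        proof (intro mult_right_mono powr_mono2)
          have "M * r\<^sub>0 \<le> M * (a * \<epsilon>)" using False p by (intro mult_left_mono) auto
          then show "M / \<epsilon> \<le> M * a / r\<^sub>0" using \<epsilon>(1) r\<^sub>0(1) by (simp add: field_simps)
        qed (use \<epsilon>(1) p in auto)
        also have "\<dots> \<le> C * X powr (q / p)" using C by (intro mult_right_mono) auto
        finally show ?thesis .
      qed
      then show "(\<Sum>x\<in>V. m x * u x powr q) \<le> C * Sobolev_mass a p V m \<epsilon> u powr (q / p)"
        unfolding X_def .
    qed
  qed
qed

section \<open>Regularity of transported measures\<close>

text \<open>
Mass is moved by at most \<open>s\<close>: the preimage of the points within distance \<open>2 * r\<close> of \<open>c\<close> contains
\<open>ball c r\<close>, and the preimage of those within distance \<open>r\<close> is contained in \<open>cball c (2 * r)\<close>.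
\<close>
lemma transported_measure_ball_regular:
  fixes \<Omega> :: "'a::euclidean_space set"
  assumes "open \<Omega>" and \<rho>: "continuous_on \<Omega> \<rho>" "0 < D" "\<And>x. x \<in> \<Omega> \<Longrightarrow> 1 / D \<le> \<rho> x \<and> \<rho> x \<le> D"
    and \<mu>: "prob_space \<mu>" "\<mu> = density (restrict_space lborel \<Omega>) (\<lambda>x. ennreal (\<rho> x))"
    and \<nu>: "finite V" "prob_space \<nu>" "sets \<nu> = Pow V"
    and T: "T \<in> borel_measurable (restrict_space borel \<Omega>)" "T \<in> \<Omega> \<rightarrow> V" "distr \<mu> \<nu> T = \<nu>"
    and s: "0 < s" "\<And>x. x \<in> \<Omega> \<Longrightarrow> dist (T x) x \<le> s"
  shows "ball_regular \<Omega> V (\<lambda>x. measure \<nu> {x}) (unit_ball_vol DIM('a) / D) (D * unit_ball_vol DIM('a) * 2 ^ DIM('a)) s"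
proof -
  interpret \<nu>: prob_space \<nu> by (rule \<nu>(2))
  interpret \<mu>: prob_space \<mu> by (rule \<mu>(1))
  have \<Omega>b: "\<Omega> \<in> sets borel" using \<open>open \<Omega>\<close> by simp
  have sets\<mu>: "sets \<mu> = sets (restrict_space borel \<Omega>)"
    unfolding \<mu>(2) by (simp add: sets_restrict_space)
  have space\<mu>: "space \<mu> = \<Omega>" unfolding \<mu>(2) by (simp add: space_restrict_space)
  have \<rho>m: "(\<lambda>x. ennreal (\<rho> x)) \<in> borel_measurable (restrict_space lborel \<Omega>)"
  proof -
    have "\<rho> \<in> borel_measurable (restrict_space borel \<Omega>)"
      using \<rho>(1) by (rule borel_measurable_continuous_on_restrict)
    then have "\<rho> \<in> borel_measurable (restrict_space lborel \<Omega>)"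
      by (simp cong: measurable_cong_sets add: sets_restrict_space)
    then show ?thesis by measurable
  qed
  have setsD: "B \<in> sets borel" "B \<subseteq> \<Omega>" if "B \<in> sets \<mu>" for B
    using that \<Omega>b unfolding sets\<mu> sets_restrict_space by auto
  have em: "emeasure \<mu> B = (\<integral>\<^sup>+x. ennreal (\<rho> x) * indicator B x \<partial>lborel)" if B: "B \<in> sets \<mu>" for B
  proof -
    have "B \<in> sets (restrict_space lborel \<Omega>)" using B by (simp add: sets\<mu> sets_restrict_space)
    then have "emeasure \<mu> B = (\<integral>\<^sup>+x. ennreal (\<rho> x) * indicator B x \<partial>restrict_space lborel \<Omega>)"
      unfolding \<mu>(2) by (rule emeasure_density[OF \<rho>m])
    also have "\<dots> = (\<integral>\<^sup>+x. ennreal (\<rho> x) * indicator B x * indicator \<Omega> x \<partial>lborel)"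
      using \<Omega>b by (simp add: nn_integral_restrict_space)
    also have "\<dots> = (\<integral>\<^sup>+x. ennreal (\<rho> x) * indicator B x \<partial>lborel)"
      using setsD(2)[OF B] by (intro nn_integral_cong) (auto simp: indicator_def)
    finally show ?thesis .
  qed
  have upper: "emeasure \<mu> B \<le> ennreal D * emeasure lborel B" if B: "B \<in> sets \<mu>" for B
  proof -
    have "emeasure \<mu> B \<le> (\<integral>\<^sup>+x. ennreal D * indicator B x \<partial>lborel)"
      unfolding em[OF B] using setsD(2)[OF B] \<rho>(3)
      by (intro nn_integral_mono) (auto simp: indicator_def ennreal_leI subset_iff)
    also have "\<dots> = ennreal D * emeasure lborel B" using setsD(1)[OF B] by (simp add: nn_integral_cmult_indicator)
    finally show ?thesis .
  qed
  have lower: "ennreal (1 / D) * emeasure lborel B \<le> emeasure \<mu> B" if B: "B \<in> sets \<mu>" for B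
  proof -
    have "ennreal (1 / D) * emeasure lborel B = (\<integral>\<^sup>+x. ennreal (1 / D) * indicator B x \<partial>lborel)"
      using setsD(1)[OF B] by (simp add: nn_integral_cmult_indicator)
    also have "\<dots> \<le> emeasure \<mu> B"
      unfolding em[OF B] using setsD(2)[OF B] \<rho>(3)
      by (intro nn_integral_mono) (auto simp: indicator_def ennreal_leI subset_iff)
    finally show ?thesis .
  qed
  have Tset: "T -` A \<inter> \<Omega> \<in> sets \<mu>" if "A \<subseteq> V" for A
  proof -
    have "finite A" using that \<nu>(1) finite_subset by blast
    then have "A \<in> sets borel" by (simp add: borel_closed finite_imp_closed)
    then show ?thesis using measurable_sets[OF T(1)] by (simp add: sets\<mu> space_restrict_space)
  qed
  have spV: "space \<nu> = V" using \<nu>(3) by (metis Pow_top Sup_subset_mono Union_Pow_eq sets.sets_into_space sets.top subset_antisym PowD)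
  have Tm: "T \<in> measurable \<mu> \<nu>"
  proof (rule measurableI)
    show "T x \<in> space \<nu>" if "x \<in> space \<mu>" for x using that T(2) by (auto simp: space\<mu> spV)
    show "T -` A \<inter> space \<mu> \<in> sets \<mu>" if "A \<in> sets \<nu>" for A
      using that Tset by (auto simp: \<nu>(3) space\<mu>)
  qed
  have push: "(\<Sum>y\<in>A. measure \<nu> {y}) = measure \<mu> (T -` A \<inter> \<Omega>)" if A: "A \<subseteq> V" for A
  proof -
    have "finite A" using A \<nu>(1) finite_subset by blast
    then have "(\<Sum>y\<in>A. measure \<nu> {y}) = measure \<nu> A"
      using A by (intro \<nu>.finite_measure_eq_sum_singleton[symmetric]) (auto simp: \<nu>(3))
    also have "\<dots> = measure (distr \<mu> \<nu> T) A" by (simp add: T(3))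
    also have "\<dots> = measure \<mu> (T -` A \<inter> \<Omega>)"
      using A by (subst measure_distr[OF Tm]) (auto simp: \<nu>(3) space\<mu>)
    finally show ?thesis .
  qed
  let ?d = "DIM('a)"
  show ?thesis
    unfolding ball_regular_def
  proof (intro conjI allI impI)
    fix c :: 'a and r :: real
    assume r: "s \<le> r" and sub: "ball c r \<subseteq> \<Omega>"
    let ?A = "{y \<in> V. dist y c < 2 * r}"
    have bs: "ball c r \<in> sets \<mu>" using sub by (auto simp: sets\<mu> sets_restrict_space)
    have "ball c r \<subseteq> T -` ?A \<inter> \<Omega>"
    proof
      fix x assume x: "x \<in> ball c r"
      then have "x \<in> \<Omega>" using sub by auto
      moreover have "dist (T x) c < 2 * r"
        using x r s(2)[OF \<open>x \<in> \<Omega>\<close>] dist_triangle[of "T x" c x] by (simp add: dist_commute)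
      ultimately show "x \<in> T -` ?A \<inter> \<Omega>" using T(2) by auto
    qed
    then have "measure \<mu> (ball c r) \<le> measure \<mu> (T -` ?A \<inter> \<Omega>)"
      by (intro \<mu>.finite_measure_mono Tset) auto
    moreover have "unit_ball_vol ?d / D * r ^ ?d \<le> measure \<mu> (ball c r)"
    proof -
      have "ennreal (unit_ball_vol ?d / D * r ^ ?d) = ennreal (1 / D) * emeasure lborel (ball c r)"
        using r s \<rho>(2) by (simp add: emeasure_ball flip: ennreal_mult)
      also have "\<dots> \<le> emeasure \<mu> (ball c r)" by (rule lower[OF bs])
      also have "\<dots> = ennreal (measure \<mu> (ball c r))" by (rule \<mu>.emeasure_eq_measure)
      finally show ?thesis by (simp add: ennreal_le_iff)
    qed
    ultimately show "unit_ball_vol ?d / D * r ^ ?d \<le> (\<Sum>y\<in>?A. measure \<nu> {y})"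
      by (subst push) auto
  next
    fix c :: 'a and r :: real
    assume r: "s \<le> r"
    let ?A = "{y \<in> V. dist y c \<le> r}"
    have As: "T -` ?A \<inter> \<Omega> \<in> sets \<mu>" by (intro Tset) auto
    have sub: "T -` ?A \<inter> \<Omega> \<subseteq> cball c (2 * r)"
    proof
      fix x assume x: "x \<in> T -` ?A \<inter> \<Omega>"
      then show "x \<in> cball c (2 * r)"
        using r s(2)[of x] dist_triangle3[of x c "T x"] by (auto simp: dist_commute)
    qed
    have "ennreal (measure \<mu> (T -` ?A \<inter> \<Omega>)) = emeasure \<mu> (T -` ?A \<inter> \<Omega>)"
      by (rule \<mu>.emeasure_eq_measure[symmetric])
    also have "\<dots> \<le> ennreal D * emeasure lborel (T -` ?A \<inter> \<Omega>)" by (rule upper[OF As])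
    also have "\<dots> \<le> ennreal D * emeasure lborel (cball c (2 * r))"
      using sub by (intro mult_left_mono emeasure_mono) auto
    also have "\<dots> = ennreal (D * unit_ball_vol ?d * 2 ^ ?d * r ^ ?d)"
      using r s \<rho>(2) by (simp add: emeasure_cball power_mult_distrib mult_ac flip: ennreal_mult)
    finally have "measure \<mu> (T -` ?A \<inter> \<Omega>) \<le> D * unit_ball_vol ?d * 2 ^ ?d * r ^ ?d"
      using r s \<rho>(2) by (subst (asm) ennreal_le_iff) auto
    then show "(\<Sum>y\<in>?A. measure \<nu> {y}) \<le> D * unit_ball_vol ?d * 2 ^ ?d * r ^ ?d"
      by (subst push) auto
  qed
qed

section \<open>The kernel and the graph energy\<close>

text \<open>
A non-increasing kernel is at least \<open>\<eta> x\<close> on \<open>[x / 2, x]\<close>, so a finite moment of order \<open>t\<close> forces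
\<open>\<eta> x\<close> to decay like \<open>x powr - (d + t)\<close>. The integer exponent \<open>d + 1\<close> is enough for summability
over dyadic shells.
\<close>
lemma kernel_decay:
  fixes \<eta> :: "real \<Rightarrow> real"
  assumes nn: "\<And>r. 0 \<le> r \<Longrightarrow> 0 \<le> \<eta> r" and mono: "antimono_on {0..} \<eta>"
    and t: "1 \<le> t" "kernel_moment d \<eta> t < \<infinity>"
  obtains B where "0 \<le> B" "\<And>x. 1 \<le> x \<Longrightarrow> \<eta> x \<le> B / x ^ (d + 1)"
proof -
  obtain I where I: "kernel_moment d \<eta> t = ennreal I" "0 \<le> I"
    using t(2) by (cases "kernel_moment d \<eta> t") auto
  have main: "\<eta> x * (x / 2) powr (real d + t) \<le> I" if x: "1 \<le> x" for x
  proof -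
    have "ennreal (\<eta> x * (x / 2) powr (real d + t))
        = ennreal (\<eta> x * (x / 2) powr (real d + t - 1)) * ennreal (x / 2)"
    proof -
      have "(x / 2) powr (real d + t) = (x / 2) powr (real d + t - 1) * (x / 2) powr 1"
        by (subst powr_add[symmetric]) simp
      then show ?thesis using x nn[of x] by (simp flip: ennreal_mult)
    qed
    also have "ennreal (x / 2) = emeasure lborel {x / 2..x}" using x by simp
    also have "ennreal (\<eta> x * (x / 2) powr (real d + t - 1)) * emeasure lborel {x / 2..x}
       = (\<integral>\<^sup>+r. ennreal (\<eta> x * (x / 2) powr (real d + t - 1)) * indicator {x / 2..x} r \<partial>lborel)"
      by (simp add: nn_integral_cmult_indicator)
    also have "\<dots> \<le> kernel_moment d \<eta> t"
      unfolding kernel_moment_def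
    proof (intro nn_integral_mono)
      fix r :: real
      show "ennreal (\<eta> x * (x / 2) powr (real d + t - 1)) * indicator {x / 2..x} r
         \<le> ennreal (\<eta> r * r powr (real d + t - 1)) * indicator {0..} r"
      proof (cases "r \<in> {x / 2..x}")
        case True
        then have "\<eta> x * (x / 2) powr (real d + t - 1) \<le> \<eta> r * r powr (real d + t - 1)"
          using x t nn[of r] nn[of x] mono
          by (intro mult_mono powr_mono2) (auto simp: monotone_on_def)
        then show ?thesis using True x by (simp add: ennreal_leI)
      qed simp
    qed
    finally show ?thesis using I by simp
  qed
  show ?thesis
  proof (rule that[of "I * 2 powr (real d + t)"])
    show "0 \<le> I * 2 powr (real d + t)" using I by simp
    fix x :: real assume x: "1 \<le> x"
    have "x ^ (d + 1) = x powr real (d + 1)" using x by (subst powr_realpow) auto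
    also have "\<dots> \<le> x powr (real d + t)" using x t by (intro powr_mono) auto
    finally have "\<eta> x * x ^ (d + 1) \<le> \<eta> x * x powr (real d + t)"
      using nn[of x] x by (intro mult_left_mono) auto
    also have "\<dots> = (\<eta> x * (x / 2) powr (real d + t)) * 2 powr (real d + t)"
      using x by (simp add: powr_divide)
    also have "\<dots> \<le> I * 2 powr (real d + t)" using main[OF x] by (intro mult_right_mono) auto
    finally show "\<eta> x \<le> I * 2 powr (real d + t) / x ^ (d + 1)" using x by (simp add: field_simps)
  qed
qed

text \<open>
The discrete analogue of integrability of \<open>\<eta>\<close> over the space, uniform in \<open>\<epsilon>\<close>: the kernel is
dominated by a sum of multiples of indicator functions of balls of radii \<open>L * 2 ^ (k + 1)\<close>, whose
weights are known, and the resulting series is geometric. Radii start at \<open>L \<ge> K\<close> because smaller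
balls are below the scale of regularity.
\<close>
lemma kernel_sum_bound:
  fixes V :: "'a::euclidean_space set" and \<eta> :: "real \<Rightarrow> real"
  assumes nn: "\<And>r. 0 \<le> r \<Longrightarrow> 0 \<le> \<eta> r" and mono: "antimono_on {0..} \<eta>"
    and B: "0 \<le> B" "\<And>x. 1 \<le> x \<Longrightarrow> \<eta> x \<le> B / x ^ (DIM('a) + 1)"
    and V: "finite V" "\<And>x. x \<in> V \<Longrightarrow> 0 \<le> m x" and reg: "ball_regular \<Omega> V m c\<^sub>1 c\<^sub>2 (K * \<epsilon>)"
    and "0 < \<epsilon>" "0 \<le> c\<^sub>2" "1 \<le> L" "K \<le> L"
  shows "(\<Sum>y\<in>V. scaled_kernel DIM('a) \<eta> \<epsilon> (norm (x - y)) * m y)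
     \<le> c\<^sub>2 * L ^ DIM('a) * (\<eta> 0 + 2 * 2 ^ DIM('a) * B)"
proof -
  define d where "d = DIM('a)"
  have layer: "\<eta> s \<le> \<eta> 0 * (if s \<le> L then 1 else 0)
       + (\<Sum>k<n. B / (2 ^ k) ^ (d + 1) * (if s \<le> L * 2 ^ (k + 1) then 1 else 0))"
    if "0 \<le> s" "s \<le> L * 2 ^ n" for s n
    using that(2)
  proof (induction n)
    case 0
    then show ?case using mono that(1) by (auto simp: monotone_on_def)
  next
    case (Suc n)
    show ?case
    proof (cases "s \<le> L * 2 ^ n")
      case True
      have "0 \<le> B / (2 ^ n) ^ (d + 1) * (if s \<le> L * 2 ^ (n + 1) then 1 else 0)" using B(1) by simp
      then show ?thesis using Suc.IH[OF True] unfolding sum.lessThan_Suc by linarith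
    next
      case False
      have "(1::real) * 2 ^ n \<le> L * 2 ^ n" using \<open>1 \<le> L\<close> by (intro mult_right_mono) auto
      then have "2 ^ n \<le> s" using False by linarith
      then have "\<eta> s \<le> \<eta> (2 ^ n)" using mono that(1) by (auto simp: monotone_on_def)
      also have "\<dots> \<le> B / (2 ^ n) ^ (d + 1)" unfolding d_def by (intro B) simp
      finally have "\<eta> s \<le> B / (2 ^ n) ^ (d + 1)" .
      moreover have "0 \<le> \<eta> 0 * (if s \<le> L then 1 else 0)" using nn[of 0] by simp
      moreover have "0 \<le> (\<Sum>k<n. B / (2 ^ k) ^ (d + 1) * (if s \<le> L * 2 ^ (k + 1) then 1 else 0))"
        using B(1) by (intro sum_nonneg) auto
      ultimately show ?thesis using Suc.prems by simp
    qed
  qed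
  have mass: "(\<Sum>y\<in>V. (if norm (x - y) / \<epsilon> \<le> L * b then 1 else 0) * m y) \<le> c\<^sub>2 * (L * b) ^ d * \<epsilon> ^ d" if "1 \<le> b" for b
  proof -
    have "L * 1 \<le> L * b" using \<open>1 \<le> L\<close> that by (intro mult_left_mono) auto
    then have "K \<le> L * b" using \<open>K \<le> L\<close> by linarith
    then have "K * \<epsilon> \<le> L * b * \<epsilon>" using \<open>0 < \<epsilon>\<close> by simp
    then have "(\<Sum>y\<in>{y\<in>V. dist y x \<le> L * b * \<epsilon>}. m y) \<le> c\<^sub>2 * (L * b * \<epsilon>) ^ d"
      using reg unfolding ball_regular_def d_def by blast
    moreover have "(\<Sum>y\<in>V. (if norm (x - y) / \<epsilon> \<le> L * b then 1 else 0) * m y)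
       = (\<Sum>y\<in>{y\<in>V. dist y x \<le> L * b * \<epsilon>}. m y)"
      using V \<open>0 < \<epsilon>\<close> by (intro sum.mono_neutral_cong_right) (auto simp: dist_norm norm_minus_commute field_simps)
    ultimately show ?thesis by (simp add: power_mult_distrib)
  qed
  obtain n where n: "\<And>y. y \<in> V \<Longrightarrow> norm (x - y) / \<epsilon> \<le> L * 2 ^ n"
  proof -
    obtain n where n: "(\<Sum>y\<in>V. norm (x - y) / \<epsilon>) < 2 ^ n"
      using real_arch_pow[of 2] by auto
    show ?thesis
    proof (rule that[of n])
      fix y assume "y \<in> V"
      then have "norm (x - y) / \<epsilon> \<le> (\<Sum>y\<in>V. norm (x - y) / \<epsilon>)"
        using V \<open>0 < \<epsilon>\<close> by (intro member_le_sum[where f="\<lambda>y. norm (x - y) / \<epsilon>"]) auto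
      also have "\<dots> \<le> 1 * 2 ^ n" using n by simp
      also have "\<dots> \<le> L * 2 ^ n" using \<open>1 \<le> L\<close> by (intro mult_right_mono) auto
      finally show "norm (x - y) / \<epsilon> \<le> L * 2 ^ n" .
    qed
  qed
  have "(\<Sum>y\<in>V. \<eta> (norm (x - y) / \<epsilon>) * m y)
     \<le> (\<Sum>y\<in>V. (\<eta> 0 * (if norm (x - y) / \<epsilon> \<le> L * 1 then 1 else 0)
       + (\<Sum>k<n. B / (2 ^ k) ^ (d + 1) * (if norm (x - y) / \<epsilon> \<le> L * 2 ^ (k + 1) then 1 else 0))) * m y)"
    using layer[OF _ n] V \<open>0 < \<epsilon>\<close> by (intro sum_mono mult_right_mono) auto
  also have "\<dots> = \<eta> 0 * (\<Sum>y\<in>V. (if norm (x - y) / \<epsilon> \<le> L * 1 then 1 else 0) * m y)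
     + (\<Sum>k<n. B / (2 ^ k) ^ (d + 1) * (\<Sum>y\<in>V. (if norm (x - y) / \<epsilon> \<le> L * 2 ^ (k + 1) then 1 else 0) * m y))"
    unfolding distrib_right sum.distrib sum_distrib_left sum_distrib_right
    by (subst (2) sum.swap) (simp only: mult.assoc)
  also have "\<dots> \<le> \<eta> 0 * (c\<^sub>2 * (L * 1) ^ d * \<epsilon> ^ d)
     + (\<Sum>k<n. B / (2 ^ k) ^ (d + 1) * (c\<^sub>2 * (L * 2 ^ (k + 1)) ^ d * \<epsilon> ^ d))"
    using nn[of 0] B(1) by (intro add_mono sum_mono mult_left_mono mass) (auto simp del: power_Suc)
  also have "(\<Sum>k<n. B / (2 ^ k) ^ (d + 1) * (c\<^sub>2 * (L * 2 ^ (k + 1)) ^ d * \<epsilon> ^ d))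
     = B * c\<^sub>2 * L ^ d * 2 ^ d * \<epsilon> ^ d * (\<Sum>k<n. (1/2) ^ k)"
    unfolding sum_distrib_left
    by (intro sum.cong refl) (simp add: power_mult_distrib power_one_over field_simps)
  also have "\<dots> \<le> B * c\<^sub>2 * L ^ d * 2 ^ d * \<epsilon> ^ d * 2"
  proof -
    have "(\<Sum>k<n. (1/2::real) ^ k) \<le> 2" by (simp add: geometric_sum)
    then show ?thesis using assms by (intro mult_left_mono) auto
  qed
  finally have "(\<Sum>y\<in>V. \<eta> (norm (x - y) / \<epsilon>) * m y) \<le> (c\<^sub>2 * L ^ d * (\<eta> 0 + 2 * 2 ^ d * B)) * \<epsilon> ^ d"
    by (simp add: algebra_simps)
  moreover have "(\<Sum>y\<in>V. scaled_kernel DIM('a) \<eta> \<epsilon> (norm (x - y)) * m y) = (\<Sum>y\<in>V. \<eta> (norm (x - y) / \<epsilon>) * m y) / \<epsilon> ^ d"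
    by (simp add: scaled_kernel_def d_def sum_divide_distrib)
  ultimately show ?thesis using \<open>0 < \<epsilon>\<close> by (simp add: d_def divide_le_eq)
qed

lemma kernel_positive_near_0:
  fixes \<eta> :: "real \<Rightarrow> real"
  assumes "continuous (at 0 within {0..}) \<eta>" "0 < \<eta> 0"
  obtains a where "0 < a" "\<And>r. 0 \<le> r \<Longrightarrow> r \<le> a \<Longrightarrow> \<eta> 0 / 2 \<le> \<eta> r"
proof -
  obtain \<delta> where \<delta>: "0 < \<delta>" "\<And>r. r \<in> {0..} \<Longrightarrow> dist r 0 < \<delta> \<Longrightarrow> dist (\<eta> r) (\<eta> 0) < \<eta> 0 / 2"
    using assms unfolding continuous_within_eps_delta by (metis half_gt_zero)
  show ?thesis
  proof (rule that[of "\<delta> / 2"])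
    fix r :: real assume "0 \<le> r" "r \<le> \<delta> / 2"
    then have "dist (\<eta> r) (\<eta> 0) < \<eta> 0 / 2" using \<delta> by (intro \<delta>(2)) auto
    then show "\<eta> 0 / 2 \<le> \<eta> r" unfolding dist_real_def by linarith
  qed (use \<delta> in auto)
qed

lemma short_range_energy_le_graph_energy:
  fixes V :: "'a::euclidean_space set"
  assumes nn: "\<And>r. 0 \<le> r \<Longrightarrow> 0 \<le> \<eta> r" and \<eta>: "\<And>r. 0 \<le> r \<Longrightarrow> r \<le> a \<Longrightarrow> c \<le> \<eta> r"
    and "finite V" "0 < \<epsilon>" "0 \<le> p"
  shows "c * short_range_energy V (\<lambda>x. measure \<nu> {x}) (a * \<epsilon>) p (\<lambda>x. \<bar>u x\<bar>) / (\<epsilon> ^ DIM('a) * \<epsilon> powr p)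
     \<le> graph_energy \<eta> V \<nu> \<epsilon> p u"
proof -
  let ?m = "\<lambda>x. measure \<nu> {x}"
  have "c * short_range_energy V ?m (a * \<epsilon>) p (\<lambda>x. \<bar>u x\<bar>)
     = (\<Sum>x\<in>V. \<Sum>y\<in>{y\<in>V. dist x y \<le> a * \<epsilon>}. c * (?m x * ?m y * \<bar>\<bar>u x\<bar> - \<bar>u y\<bar>\<bar> powr p))"
    by (simp add: short_range_energy_def sum_distrib_left)
  also have "\<dots> \<le> (\<Sum>x\<in>V. \<Sum>y\<in>{y\<in>V. dist x y \<le> a * \<epsilon>}. \<eta> (norm (x - y) / \<epsilon>) * (?m x * ?m y * \<bar>u x - u y\<bar> powr p))"
  proof (intro sum_mono)
    fix x y assume y: "y \<in> {y\<in>V. dist x y \<le> a * \<epsilon>}"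
    show "c * (?m x * ?m y * \<bar>\<bar>u x\<bar> - \<bar>u y\<bar>\<bar> powr p) \<le> \<eta> (norm (x - y) / \<epsilon>) * (?m x * ?m y * \<bar>u x - u y\<bar> powr p)"
    proof (rule mult_mono)
      show "c \<le> \<eta> (norm (x - y) / \<epsilon>)"
        using y \<open>0 < \<epsilon>\<close> by (intro \<eta>) (simp_all add: dist_norm divide_le_eq)
      show "0 \<le> \<eta> (norm (x - y) / \<epsilon>)" using \<open>0 < \<epsilon>\<close> by (intro nn) simp
      show "?m x * ?m y * \<bar>\<bar>u x\<bar> - \<bar>u y\<bar>\<bar> powr p \<le> ?m x * ?m y * \<bar>u x - u y\<bar> powr p"
        using \<open>0 \<le> p\<close> by (intro mult_left_mono powr_mono2) auto
    qed simp
  qed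
  also have "\<dots> \<le> (\<Sum>x\<in>V. \<Sum>y\<in>V. \<eta> (norm (x - y) / \<epsilon>) * (?m x * ?m y * \<bar>u x - u y\<bar> powr p))"
    using \<open>finite V\<close> \<open>0 < \<epsilon>\<close> by (intro sum_mono sum_mono2) (auto intro!: mult_nonneg_nonneg nn)
  finally have "c * short_range_energy V ?m (a * \<epsilon>) p (\<lambda>x. \<bar>u x\<bar>) / (\<epsilon> ^ DIM('a) * \<epsilon> powr p)
     \<le> (\<Sum>x\<in>V. \<Sum>y\<in>V. \<eta> (norm (x - y) / \<epsilon>) * (?m x * ?m y * \<bar>u x - u y\<bar> powr p)) / (\<epsilon> ^ DIM('a) * \<epsilon> powr p)"
    using \<open>0 < \<epsilon>\<close> by (intro divide_right_mono) auto
  also have "\<dots> = graph_energy \<eta> V \<nu> \<epsilon> p u"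
    by (simp add: graph_energy_def scaled_kernel_def sum_divide_distrib sum_distrib_left mult_ac)
  finally show ?thesis .
qed

lemma graph_energy_nonneg:
  assumes "\<And>r. 0 \<le> r \<Longrightarrow> 0 \<le> \<eta> r" "0 < \<epsilon>"
  shows "0 \<le> graph_energy \<eta> V \<nu> \<epsilon> p u"
  unfolding graph_energy_def scaled_kernel_def using assms
  by (intro mult_nonneg_nonneg sum_nonneg divide_nonneg_nonneg) auto

text \<open>
Only the pairs with exactly one entry equal to \<open>z\<close> contribute, each once in either order.
\<close>
lemma graph_energy_indicator:
  fixes V :: "'a::euclidean_space set"
  assumes "finite V" "z \<in> V" "0 < \<epsilon>" and nn: "\<And>r. 0 \<le> r \<Longrightarrow> 0 \<le> \<eta> r" "0 \<le> p"
  shows "graph_energy \<eta> V \<nu> \<epsilon> p (indicator {z})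
    \<le> 2 * measure \<nu> {z} * (\<Sum>y\<in>V. scaled_kernel DIM('a) \<eta> \<epsilon> (norm (z - y)) * measure \<nu> {y}) / \<epsilon> powr p"
proof -
  let ?m = "\<lambda>x. measure \<nu> {x}" and ?k = "\<lambda>x y. scaled_kernel DIM('a) \<eta> \<epsilon> (norm (x - y))"
  have k0: "0 \<le> ?k x y" for x y using nn(1) \<open>0 < \<epsilon>\<close> by (simp add: scaled_kernel_def)
  have "(\<Sum>x\<in>V. \<Sum>y\<in>V. ?k x y * \<bar>indicator {z} x - indicator {z} y\<bar> powr p * ?m x * ?m y)
     \<le> (\<Sum>x\<in>V. \<Sum>y\<in>V. (if x = z then ?k x y * ?m x * ?m y else 0) + (if y = z then ?k x y * ?m x * ?m y else 0))"
    using k0 k0[of z z] by (intro sum_mono) (auto simp: indicator_def intro!: mult_nonneg_nonneg)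
  also have "\<dots> = (\<Sum>x\<in>V. \<Sum>y\<in>V. (if x = z then ?k x y * ?m x * ?m y else 0))
      + (\<Sum>x\<in>V. \<Sum>y\<in>V. (if y = z then ?k x y * ?m x * ?m y else 0))"
    by (simp add: sum.distrib)
  also have "(\<Sum>x\<in>V. \<Sum>y\<in>V. (if x = z then ?k x y * ?m x * ?m y else 0)) = (\<Sum>y\<in>V. ?k z y * ?m z * ?m y)"
    using assms(1,2) by (subst sum.swap) (simp add: sum.delta)
  also have "(\<Sum>x\<in>V. \<Sum>y\<in>V. (if y = z then ?k x y * ?m x * ?m y else 0)) = (\<Sum>x\<in>V. ?k x z * ?m x * ?m z)"
    using assms(1,2) by (simp add: sum.delta)
  also have "(\<Sum>y\<in>V. ?k z y * ?m z * ?m y) + (\<Sum>x\<in>V. ?k x z * ?m x * ?m z) = 2 * ?m z * (\<Sum>y\<in>V. ?k z y * ?m y)"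
    by (simp add: sum_distrib_left norm_minus_commute[of _ z] mult_ac flip: sum.distrib)
  finally have "(\<Sum>x\<in>V. \<Sum>y\<in>V. ?k x y * \<bar>indicator {z} x - indicator {z} y\<bar> powr p * ?m x * ?m y) / \<epsilon> powr p
     \<le> 2 * ?m z * (\<Sum>y\<in>V. ?k z y * ?m y) / \<epsilon> powr p"
    by (intro divide_right_mono) auto
  then show ?thesis by (simp add: graph_energy_def)
qed

lemma graph_Lp_norm_indicator:
  assumes "finite V" "z \<in> V" "0 < p"
  shows "graph_Lp_norm V \<nu> p (indicator {z}) = measure \<nu> {z} powr (1 / p)"
proof -
  have "(\<Sum>x\<in>V. \<bar>indicator {z} x\<bar> powr p * measure \<nu> {x}) = (\<Sum>x\<in>V. if x = z then measure \<nu> {z} else 0)"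
    by (intro sum.cong) (auto simp: indicator_def)
  then show ?thesis using assms by (simp add: graph_Lp_norm_def sum.delta)
qed

section \<open>The uniform graph Sobolev inequality\<close>

theorem theorem5p10:
  fixes \<Omega> :: "'a::euclidean_space set" and \<eta> :: "real \<Rightarrow> real"
  assumes "open \<Omega>" and "bounded \<Omega>" and "lipschitz_boundary \<Omega>"
    and "\<forall>r\<ge>0. 0 \<le> \<eta> r"
  shows "\<exists>S>0. \<forall>(p::real) (q::real) \<mu> \<rho> V \<nu> (\<epsilon> :: nat \<Rightarrow> real) K T D t.
      1 \<le> p \<and> p < real DIM('a) \<and> p \<le> q \<and> q \<le> real DIM('a) * p / (real DIM('a) - p) \<and>
      graph_setting \<Omega> \<mu> \<rho> V \<nu> \<epsilon> \<and>
      0 < K \<and> K \<le> S \<and>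
      (\<forall>n\<ge>1. T n \<in> borel_measurable (restrict_space borel \<Omega>) \<and> T n \<in> \<Omega> \<rightarrow> V n \<and>
             distr \<mu> (\<nu> n) (T n) = \<nu> n \<and> (\<forall>x\<in>\<Omega>. norm (T n x - x) \<le> K * \<epsilon> n)) \<and>
      continuous (at 0 within {0..}) \<eta> \<and> antimono_on {0..} \<eta> \<and> 0 < \<eta> 0 \<and>
      0 < D \<and> (\<forall>x\<in>\<Omega>. 1 / D \<le> \<rho> x \<and> \<rho> x \<le> D) \<and>
      q < t \<and> kernel_moment DIM('a) \<eta> t < \<infinity>
      \<longrightarrow>
      ((\<forall>n\<ge>1. 0 < min_weight (V n) (\<nu> n)) \<and>
       bounded ((\<lambda>n. \<epsilon> n * max_weight (V n) (\<nu> n) powr (1 / q + 1 / p)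
                        / min_weight (V n) (\<nu> n) powr (2 / p)) ` {1..})
         \<longrightarrow> uniform_graph_sobolev \<eta> V \<nu> \<epsilon> p q) \<and>
      ((\<exists>D'>0. \<forall>n\<ge>1. \<forall>x\<in>V n.
          1 / (D' * real (card (V n))) \<le> measure (\<nu> n) {x} \<and>
          measure (\<nu> n) {x} \<le> D' / real (card (V n)))
         \<longrightarrow> (uniform_graph_sobolev \<eta> V \<nu> \<epsilon> p q \<longleftrightarrow>
              bounded ((\<lambda>n. \<epsilon> n * real (card (V n)) powr (1 / p - 1 / q)) ` {1..})))"
proof (cases "continuous (at 0 within {0..}) \<eta> \<and> 0 < \<eta> 0")
  case False
  then show ?thesis by (intro exI[of _ 1]) auto
next
  case True
  then obtain a where a: "0 < a" "\<And>r. 0 \<le> r \<Longrightarrow> r \<le> a \<Longrightarrow> \<eta> 0 / 2 \<le> \<eta> r"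
    using kernel_positive_near_0 by metis
  have nn: "\<And>r. 0 \<le> r \<Longrightarrow> 0 \<le> \<eta> r" and \<eta>0: "0 < \<eta> 0" using assms(4) True by auto
  obtain S where S: "0 < S" and core: "\<And>p q c\<^sub>1 c\<^sub>2 M.
      \<lbrakk>1 \<le> p; p < real DIM('a); p \<le> q; q \<le> real DIM('a) * p / (real DIM('a) - p); 0 < c\<^sub>1; 0 < c\<^sub>2; 0 \<le> M\<rbrakk> \<Longrightarrow>
      \<exists>C\<ge>0. \<forall>V m \<epsilon> u. regular_graph \<Omega> c\<^sub>1 c\<^sub>2 S M (1/p - 1/q) V m \<epsilon> \<and> (\<forall>x\<in>V. 0 \<le> u x)
         \<longrightarrow> (\<Sum>x\<in>V. m x * u x powr q) \<le> C * Sobolev_mass a p V m \<epsilon> u powr (q / p)"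
    by (rule graph_Sobolev_short_range[OF assms(1-3) a(1)]) (rule that)
  show ?thesis
  proof (intro exI[of _ S] conjI[OF S] allI, rule impI)
    fix p q :: real and \<mu> :: "'a measure" and \<rho> V \<nu> and \<epsilon> :: "nat \<Rightarrow> real" and K T D t
    assume hyp: "1 \<le> p \<and> p < real DIM('a) \<and> p \<le> q \<and> q \<le> real DIM('a) * p / (real DIM('a) - p) \<and>
      graph_setting \<Omega> \<mu> \<rho> V \<nu> \<epsilon> \<and>
      0 < K \<and> K \<le> S \<and>
      (\<forall>n\<ge>1. T n \<in> borel_measurable (restrict_space borel \<Omega>) \<and> T n \<in> \<Omega> \<rightarrow> V n \<and>
             distr \<mu> (\<nu> n) (T n) = \<nu> n \<and> (\<forall>x\<in>\<Omega>. norm (T n x - x) \<le> K * \<epsilon> n)) \<and>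
      continuous (at 0 within {0..}) \<eta> \<and> antimono_on {0..} \<eta> \<and> 0 < \<eta> 0 \<and>
      0 < D \<and> (\<forall>x\<in>\<Omega>. 1 / D \<le> \<rho> x \<and> \<rho> x \<le> D) \<and>
      q < t \<and> kernel_moment DIM('a) \<eta> t < \<infinity>"
    define \<gamma> where "\<gamma> = 1/p - 1/q"
    have p: "1 \<le> p" "p < real DIM('a)" and q: "p \<le> q" "q \<le> real DIM('a) * p / (real DIM('a) - p)"
      and K: "0 < K" "K \<le> S" and D: "0 < D" and mono: "antimono_on {0..} \<eta>" and t: "q < t"
      using hyp by auto
    have \<gamma>: "0 \<le> \<gamma>" using p q by (simp add: \<gamma>_def frac_le)
    have V: "finite (V n)" "V n \<subseteq> \<Omega>" "prob_space (\<nu> n)" "sets (\<nu> n) = Pow (V n)" and \<epsilon>: "0 < \<epsilon> n" if "1 \<le> n" for n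
      using hyp that unfolding graph_setting_def by auto
    have \<epsilon>lim: "\<epsilon> \<longlonglongrightarrow> 0" using hyp unfolding graph_setting_def by auto
    have Vne: "V n \<noteq> {}" if "1 \<le> n" for n
    proof
      assume "V n = {}"
      then have "space (\<nu> n) = {}" using V(4)[OF that] sets.top[of "\<nu> n"] by auto
      then show False using prob_space.not_empty[OF V(3)[OF that]] by simp
    qed
    let ?c = "unit_ball_vol DIM('a) / D" and ?C = "D * unit_ball_vol DIM('a) * 2 ^ DIM('a)"
    have cpos: "0 < ?c" "0 < ?C" using D by auto
    have reg: "ball_regular \<Omega> (V n) (\<lambda>x. measure (\<nu> n) {x}) ?c ?C (K * \<epsilon> n)" if n: "1 \<le> n" for n
    proof (rule transported_measure_ball_regular[OF assms(1)])
      show "continuous_on \<Omega> \<rho>" "prob_space \<mu>" "\<mu> = density (restrict_space lborel \<Omega>) (\<lambda>x. ennreal (\<rho> x))"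
        using hyp unfolding graph_setting_def by auto
      show "T n \<in> borel_measurable (restrict_space borel \<Omega>)" "T n \<in> \<Omega> \<rightarrow> V n" "distr \<mu> (\<nu> n) (T n) = \<nu> n"
        using hyp n by auto
      show "dist (T n x) x \<le> K * \<epsilon> n" if "x \<in> \<Omega>" for x using hyp n that by (auto simp: dist_norm)
    qed (use V[OF n] K \<epsilon>[OF n] D hyp in auto)
    \<comment> \<open>Both boundedness conditions of the theorem imply the assumption made here.\<close>
    have sufficient: "uniform_graph_sobolev \<eta> V \<nu> \<epsilon> p q"
      if M: "0 \<le> M" and wt: "\<And>n x. 1 \<le> n \<Longrightarrow> x \<in> V n \<Longrightarrow> 0 < measure (\<nu> n) {x} \<and> \<epsilon> n \<le> M * measure (\<nu> n) {x} powr \<gamma>" for M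
    proof -
      obtain C where C: "0 \<le> C" and CX: "\<And>V m \<epsilon> u. regular_graph \<Omega> ?c ?C S M (1/p - 1/q) V m \<epsilon> \<and> (\<forall>x\<in>V. 0 \<le> u x)
         \<Longrightarrow> (\<Sum>x\<in>V. m x * u x powr q) \<le> C * Sobolev_mass a p V m \<epsilon> u powr (q / p)"
        using core[OF p q cpos M] by blast
      \<comment> \<open>On \<open>[0, a]\<close> the kernel is at least \<open>\<eta> 0 / 2\<close>, which costs the factor \<open>2 / \<eta> 0\<close>.\<close>
      define B where "B = 1 + 2 / \<eta> 0"
      have B: "1 \<le> B" "2 / \<eta> 0 \<le> B" using \<eta>0 by (auto simp: B_def)
      define C' where "C' = C powr (1/q) * (B powr (1/p) * 2 powr (1/p)) + 1"
      have "graph_Lp_norm (V n) (\<nu> n) q u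
         \<le> C' * (graph_Lp_norm (V n) (\<nu> n) p u + graph_energy \<eta> (V n) (\<nu> n) (\<epsilon> n) p u powr (1 / p))"
        if n: "1 \<le> n" for n u
      proof -
        let ?m = "\<lambda>x. measure (\<nu> n) {x}"
        define U where "U = (\<Sum>x\<in>V n. \<bar>u x\<bar> powr p * ?m x)"
        define G where "G = graph_energy \<eta> (V n) (\<nu> n) (\<epsilon> n) p u"
        define E where "E = short_range_energy (V n) ?m (a * \<epsilon> n) p (\<lambda>x. \<bar>u x\<bar>) / (\<epsilon> n ^ DIM('a) * \<epsilon> n powr p)"
        have U0: "0 \<le> U" by (auto simp: U_def intro!: sum_nonneg)
        have E0: "0 \<le> E"
          unfolding E_def using \<epsilon>[OF n] by (intro divide_nonneg_nonneg short_range_energy_nonneg) auto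
        have EG: "\<eta> 0 / 2 * E \<le> G"
          using short_range_energy_le_graph_energy[of \<eta> a "\<eta> 0 / 2" "V n" "\<epsilon> n" p "\<nu> n" u] nn a V(1)[OF n] \<epsilon>[OF n] p
          by (simp add: E_def G_def)
        have G0: "0 \<le> G"
          unfolding G_def using nn \<epsilon>[OF n] by (intro graph_energy_nonneg) auto
        have "E \<le> 2 / \<eta> 0 * G" using EG \<eta>0 by (simp add: field_simps)
        also have "\<dots> \<le> B * G" using B G0 by (intro mult_right_mono) auto
        finally have X: "U + E \<le> B * (U + G)"
          using B U0 mult_right_mono[OF B(1) U0] by (simp add: algebra_simps)
        have "regular_graph \<Omega> ?c ?C S M (1/p - 1/q) (V n) ?m (\<epsilon> n)"
          unfolding regular_graph_def
        proof (intro conjI ballI)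
          show "ball_regular \<Omega> (V n) ?m ?c ?C (S * \<epsilon> n)"
            using reg[OF n] K \<epsilon>[OF n] by (elim ball_regular_mono) (intro mult_right_mono, auto)
        qed (use V[OF n] \<epsilon>[OF n] wt[OF n] in \<open>auto simp: \<gamma>_def\<close>)
        then have "(\<Sum>x\<in>V n. ?m x * \<bar>u x\<bar> powr q) \<le> C * Sobolev_mass a p (V n) ?m (\<epsilon> n) (\<lambda>x. \<bar>u x\<bar>) powr (q / p)"
          by (intro CX) auto
        also have "Sobolev_mass a p (V n) ?m (\<epsilon> n) (\<lambda>x. \<bar>u x\<bar>) = U + E"
          by (simp add: Sobolev_mass_def U_def E_def mult.commute)
        also have "C * (U + E) powr (q / p) \<le> C * (B * (U + G)) powr (q / p)"
          using X U0 E0 C p q by (intro mult_left_mono powr_mono2) auto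
        finally have "(\<Sum>x\<in>V n. ?m x * \<bar>u x\<bar> powr q) \<le> C * (B * (U + G)) powr (q / p)" .
        then have "graph_Lp_norm (V n) (\<nu> n) q u \<le> (C * (B * (U + G)) powr (q / p)) powr (1 / q)"
          unfolding graph_Lp_norm_def using p q by (intro powr_mono2) (auto simp: mult.commute intro!: sum_nonneg)
        also have "\<dots> = C powr (1/q) * (B powr (1/p) * (U + G) powr (1/p))"
          using p q by (simp add: powr_mult powr_powr)
        also have "\<dots> \<le> C powr (1/q) * (B powr (1/p) * (2 powr (1/p) * (U powr (1/p) + G powr (1/p))))"
          using U0 G0 p by (intro mult_left_mono powr_add_le) auto
        also have "\<dots> = (C powr (1/q) * (B powr (1/p) * 2 powr (1/p))) * (U powr (1/p) + G powr (1/p))"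
          by (simp add: mult_ac)
        also have "\<dots> \<le> C' * (U powr (1/p) + G powr (1/p))"
          unfolding C'_def by (intro mult_right_mono) auto
        finally show ?thesis by (simp add: U_def G_def graph_Lp_norm_def)
      qed
      moreover have "0 < C'" unfolding C'_def by (intro add_nonneg_pos) auto
      ultimately show ?thesis unfolding uniform_graph_sobolev_def by blast
    qed
    show "((\<forall>n\<ge>1. 0 < min_weight (V n) (\<nu> n)) \<and>
       bounded ((\<lambda>n. \<epsilon> n * max_weight (V n) (\<nu> n) powr (1 / q + 1 / p)
                        / min_weight (V n) (\<nu> n) powr (2 / p)) ` {1..})
         \<longrightarrow> uniform_graph_sobolev \<eta> V \<nu> \<epsilon> p q) \<and>
      ((\<exists>D'>0. \<forall>n\<ge>1. \<forall>x\<in>V n.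
          1 / (D' * real (card (V n))) \<le> measure (\<nu> n) {x} \<and>
          measure (\<nu> n) {x} \<le> D' / real (card (V n)))
         \<longrightarrow> (uniform_graph_sobolev \<eta> V \<nu> \<epsilon> p q \<longleftrightarrow>
              bounded ((\<lambda>n. \<epsilon> n * real (card (V n)) powr (1 / p - 1 / q)) ` {1..})))"
    proof (intro conjI impI)
      assume h: "(\<forall>n\<ge>1. 0 < min_weight (V n) (\<nu> n)) \<and>
       bounded ((\<lambda>n. \<epsilon> n * max_weight (V n) (\<nu> n) powr (1 / q + 1 / p)
                        / min_weight (V n) (\<nu> n) powr (2 / p)) ` {1..})"
      then obtain M where M: "0 < M" "\<And>n. 1 \<le> n \<Longrightarrow> \<bar>\<epsilon> n * max_weight (V n) (\<nu> n) powr (1 / q + 1 / p)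
                        / min_weight (V n) (\<nu> n) powr (2 / p)\<bar> \<le> M"
        unfolding bounded_pos by auto
      show "uniform_graph_sobolev \<eta> V \<nu> \<epsilon> p q"
      proof (rule sufficient[of M])
        fix n x assume n: "1 \<le> n" and x: "x \<in> V n"
        let ?l = "min_weight (V n) (\<nu> n)" and ?L = "max_weight (V n) (\<nu> n)"
        have l: "0 < ?l" using h n by auto
        have lx: "?l \<le> measure (\<nu> n) {x}" "?l \<le> ?L"
        proof -
          show "?l \<le> measure (\<nu> n) {x}" unfolding min_weight_def using V(1)[OF n] x by auto
          also have "\<dots> \<le> ?L" unfolding max_weight_def using V(1)[OF n] x by auto
          finally show "?l \<le> ?L" .
        qed
        \<comment> \<open>As \<open>?l \<le> ?L\<close>, the quotient bounded by \<open>M\<close> is at least \<open>\<epsilon> n * ?l powr - \<gamma>\<close>.\<close>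
        have "\<epsilon> n * ?l powr (1/q + 1/p) \<le> \<epsilon> n * ?L powr (1/q + 1/p)"
          using lx l \<epsilon>[OF n] p q by (intro mult_left_mono powr_mono2) auto
        also have "\<dots> \<le> M * ?l powr (2/p)"
          using M(2)[OF n] l by (simp add: abs_le_iff divide_le_eq)
        also have "\<dots> = (M * ?l powr \<gamma>) * ?l powr (1/q + 1/p)"
          by (simp add: \<gamma>_def mult.assoc flip: powr_add)
        finally have "\<epsilon> n \<le> M * ?l powr \<gamma>" using l by simp
        also have "\<dots> \<le> M * measure (\<nu> n) {x} powr \<gamma>"
          using lx l M \<gamma> by (intro mult_left_mono powr_mono2) auto
        finally show "0 < measure (\<nu> n) {x} \<and> \<epsilon> n \<le> M * measure (\<nu> n) {x} powr \<gamma>"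
          using l lx by linarith
      qed (use M in auto)
    next
      assume "\<exists>D'>0. \<forall>n\<ge>1. \<forall>x\<in>V n.
          1 / (D' * real (card (V n))) \<le> measure (\<nu> n) {x} \<and>
          measure (\<nu> n) {x} \<le> D' / real (card (V n))"
      then obtain D' where D': "0 < D'" and wt: "\<And>n x. 1 \<le> n \<Longrightarrow> x \<in> V n \<Longrightarrow>
          1 / (D' * real (card (V n))) \<le> measure (\<nu> n) {x} \<and> measure (\<nu> n) {x} \<le> D' / real (card (V n))"
        by blast
      have card: "0 < real (card (V n))" if "1 \<le> n" for n
        using V(1)[OF that] Vne[OF that] by (simp add: card_gt_0_iff)
      have pos: "0 < measure (\<nu> n) {x}" if "1 \<le> n" "x \<in> V n" for n x
        using wt[OF that] card[OF that(1)] D' by (smt (verit) divide_pos_pos mult_pos_pos)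
      show "uniform_graph_sobolev \<eta> V \<nu> \<epsilon> p q \<longleftrightarrow>
              bounded ((\<lambda>n. \<epsilon> n * real (card (V n)) powr (1 / p - 1 / q)) ` {1..})"
      proof
        assume "bounded ((\<lambda>n. \<epsilon> n * real (card (V n)) powr (1 / p - 1 / q)) ` {1..})"
        then obtain M where M: "0 < M" "\<And>n. 1 \<le> n \<Longrightarrow> \<bar>\<epsilon> n * real (card (V n)) powr \<gamma>\<bar> \<le> M"
          unfolding bounded_pos by (auto simp: \<gamma>_def)
        show "uniform_graph_sobolev \<eta> V \<nu> \<epsilon> p q"
        proof (rule sufficient[of "M * D' powr \<gamma>"])
          fix n x assume n: "1 \<le> n" and x: "x \<in> V n"
          let ?N = "real (card (V n))"
          have "1 \<le> D' * measure (\<nu> n) {x} * ?N"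
            using wt[OF n x] card[OF n] D' by (simp add: field_simps)
          then have "1 powr \<gamma> \<le> (D' * measure (\<nu> n) {x} * ?N) powr \<gamma>" using \<gamma> by (intro powr_mono2) auto
          then have "\<epsilon> n * 1 \<le> \<epsilon> n * (D' * measure (\<nu> n) {x} * ?N) powr \<gamma>"
            using \<epsilon>[OF n] by (intro mult_left_mono) auto
          also have "\<dots> = (\<epsilon> n * ?N powr \<gamma>) * (D' powr \<gamma> * measure (\<nu> n) {x} powr \<gamma>)"
            by (simp add: powr_mult mult_ac)
          also have "\<dots> \<le> M * (D' powr \<gamma> * measure (\<nu> n) {x} powr \<gamma>)"
            using M(2)[OF n] by (intro mult_right_mono) auto
          finally show "0 < measure (\<nu> n) {x} \<and> \<epsilon> n \<le> M * D' powr \<gamma> * measure (\<nu> n) {x} powr \<gamma>"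
            using pos[OF n x] by (simp add: mult_ac)
        qed (use M in auto)
      next
        assume "uniform_graph_sobolev \<eta> V \<nu> \<epsilon> p q"
        then obtain C where C: "0 < C" and sob: "\<And>n u. 1 \<le> n \<Longrightarrow> graph_Lp_norm (V n) (\<nu> n) q u
         \<le> C * (graph_Lp_norm (V n) (\<nu> n) p u + graph_energy \<eta> (V n) (\<nu> n) (\<epsilon> n) p u powr (1 / p))"
          unfolding uniform_graph_sobolev_def by blast
        obtain B where B: "0 \<le> B" "\<And>x. 1 \<le> x \<Longrightarrow> \<eta> x \<le> B / x ^ (DIM('a) + 1)"
          by (rule kernel_decay[of \<eta> t "DIM('a)"]) (use nn mono hyp p q t in auto)
        define L where "L = max 1 K"
        define H where "H = ?C * L ^ DIM('a) * (\<eta> 0 + 2 * 2 ^ DIM('a) * B)"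
        have H0: "0 \<le> H" using cpos \<eta>0 B by (simp add: H_def L_def)
        obtain Em where Em: "\<And>n. \<epsilon> n \<le> Em"
          using convergent_imp_Bseq[OF convergentI[OF \<epsilon>lim]] unfolding Bseq_def by (auto simp: abs_le_iff)
        define Q where "Q = D' powr \<gamma> * (C * (Em + (2 * H) powr (1 / p)))"
        show "bounded ((\<lambda>n. \<epsilon> n * real (card (V n)) powr (1 / p - 1 / q)) ` {1..})"
          unfolding bounded_iff
        proof (intro exI[of _ Q] ballI, elim imageE, simp only:)
          fix n :: nat assume "n \<in> {1..}"
          then have n: "1 \<le> n" by simp
          let ?N = "real (card (V n))"
          \<comment> \<open>The indicator function of one vertex, of weight \<open>w\<close>, has \<open>L\<^sup>q\<close> norm \<open>w powr (1/q)\<close>, while its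
            \<open>L\<^sup>p\<close> norm and its energy norm are at most of order \<open>w powr (1/p)\<close> and \<open>w powr (1/p) / \<epsilon>\<close>.\<close>
          obtain z where z: "z \<in> V n" using Vne[OF n] by blast
          define w where "w = measure (\<nu> n) {z}"
          have w: "0 < w" using pos[OF n z] by (simp add: w_def)
          have ker: "(\<Sum>y\<in>V n. scaled_kernel DIM('a) \<eta> (\<epsilon> n) (norm (z - y)) * measure (\<nu> n) {y}) \<le> H"
            unfolding H_def
            by (rule kernel_sum_bound[where \<Omega> = \<Omega> and K = K])
               (use nn mono B(1) reg[OF n] V[OF n] \<epsilon>[OF n] cpos in \<open>auto simp: L_def intro!: B(2)[simplified]\<close>)
          have "graph_energy \<eta> (V n) (\<nu> n) (\<epsilon> n) p (indicator {z}) \<le> 2 * w * H / \<epsilon> n powr p"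
            using graph_energy_indicator[of "V n" z "\<epsilon> n" \<eta> p "\<nu> n"] V(1)[OF n] z \<epsilon>[OF n] nn ker p w
            by (intro order_trans[OF _ divide_right_mono[OF mult_left_mono[OF ker, of "2 * w"]]]) (auto simp: w_def)
          then have "graph_energy \<eta> (V n) (\<nu> n) (\<epsilon> n) p (indicator {z}) powr (1/p) \<le> (2 * w * H / \<epsilon> n powr p) powr (1/p)"
            using p graph_energy_nonneg[of \<eta> "\<epsilon> n"] nn \<epsilon>[OF n] by (intro powr_mono2) auto
          also have "\<dots> = w powr (1/p) * ((2 * H) powr (1/p) / \<epsilon> n)"
            using \<epsilon>[OF n] p by (simp add: powr_mult powr_divide powr_powr mult_ac)
          finally have "C * (w powr (1/p) + graph_energy \<eta> (V n) (\<nu> n) (\<epsilon> n) p (indicator {z}) powr (1/p))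
             \<le> C * (w powr (1/p) + w powr (1/p) * ((2 * H) powr (1/p) / \<epsilon> n))"
            using C by (intro mult_left_mono add_left_mono) auto
          then have "w powr (1/q) \<le> C * (w powr (1/p) + w powr (1/p) * ((2 * H) powr (1/p) / \<epsilon> n))"
            using sob[OF n, of "indicator {z}"] graph_Lp_norm_indicator[OF V(1)[OF n] z, of q "\<nu> n"]
              graph_Lp_norm_indicator[OF V(1)[OF n] z, of p "\<nu> n"] p q by (simp add: w_def)
          also have "\<dots> = w powr (1/p) * (C * (1 + (2 * H) powr (1/p) / \<epsilon> n))" by (simp add: algebra_simps)
          also have "w powr (1/p) = w powr (1/q) * w powr \<gamma>" by (simp add: \<gamma>_def flip: powr_add)
          finally have "w powr (1/q) * 1 \<le> w powr (1/q) * (w powr \<gamma> * (C * (1 + (2 * H) powr (1/p) / \<epsilon> n)))"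
            by (simp only: mult.assoc mult_1_right)
          then have "1 \<le> w powr \<gamma> * (C * (1 + (2 * H) powr (1/p) / \<epsilon> n))"
            using w by (subst (asm) mult_le_cancel_left_pos) auto
          then have "\<epsilon> n * 1 \<le> \<epsilon> n * (w powr \<gamma> * (C * (1 + (2 * H) powr (1/p) / \<epsilon> n)))"
            using \<epsilon>[OF n] by (intro mult_left_mono) auto
          also have "\<dots> = w powr \<gamma> * (C * (\<epsilon> n + (2 * H) powr (1/p)))"
            using \<epsilon>[OF n] by (simp add: field_simps)
          also have "\<dots> \<le> w powr \<gamma> * (C * (Em + (2 * H) powr (1/p)))"
            using Em C by (intro mult_left_mono) auto
          finally have e1: "\<epsilon> n \<le> w powr \<gamma> * (C * (Em + (2 * H) powr (1/p)))" by simp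
          have Em0: "0 < Em" using Em[of n] \<epsilon>[OF n] by linarith
          have "\<epsilon> n * ?N powr \<gamma> \<le> (w powr \<gamma> * (C * (Em + (2 * H) powr (1/p)))) * ?N powr \<gamma>"
            by (intro mult_right_mono e1) auto
          also have "\<dots> = (w * ?N) powr \<gamma> * (C * (Em + (2 * H) powr (1/p)))"
            by (simp add: powr_mult mult_ac)
          also have "\<dots> \<le> Q"
            unfolding Q_def using wt[OF n z] card[OF n] w \<gamma> C Em0
            by (intro mult_right_mono powr_mono2) (auto simp: w_def field_simps)
          finally show "norm (\<epsilon> n * ?N powr (1/p - 1/q)) \<le> Q"
            using \<epsilon>[OF n] by (simp add: \<gamma>_def)
        qed
      qed
    qed
  qed
qed

end
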